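(* Suppose two-phase HotStuff, with leader-wait timeout function $F_p$, is run with a synchronizer satisfying the specification (P1)-(P5) given in the context for some view $\mathcal V$ and $d=2\delta$. Assume that for every $\theta$ there is a view $v$ such that for all $v'\ge v$: $F(v')>\theta$, $F_p(v')>\theta$ and $F(v')-F_p(v')>\theta$. Then all correct processes eventually decide.
   Context: Model. There are $n=3f+1$ processes $p_1,\dots,p_n$, at most $f$ of which are faulty (Byzantine, behaving arbitrarily); the others are correct. A quorum is a set of $2f+1$ processes. Processes communicate over authenticated point-to-point links. Partial synchrony: there are a time $\mathsf{GST}$ and a bound $\delta$, both unknown to the protocol, such that after $\mathsf{GST}$ messages between correct processes are delayed by at most $\delta$; before $\mathsf{GST}$ messages may be arbitrarily delayed or lost (self-addressed messages are never lost). Local clocks may drift unboundedly before $\mathsf{GST}$ and do not drift from real time after it. Local processing takes zero time. $\langle m\rangle_i$ denotes $m$ signed by $p_i$; signatures are unforgeable and $\mathsf{hash}$ is collision-resistant (both idealized as perfect). Each correct process has a proposal $\mathtt{myval}()$ satisfying a given predicate $\mathsf{valid}$. Synchronizer. Views are $1,2,\dots$; $0$ denotes an invalid view. A synchronizer issues notifications $\mathtt{new\_view}(v)$ at each correct process, which then enters $v$ and stays in it until it enters another view. Each correct process eventually calls the synchronizer's function $\mathtt{start}()$. The timeout function $F:\{0,1,2,\dots\}\to\mathsf{Time}$ is monotone with $F(0)=0$. $E_i(v)$ is the time when correct $p_i$ enters $v$; $E_{\rm first}(v)$, $E_{\rm last}(v)$ are the earliest and latest times when some correct process enters $v$. Specification,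 for a view $\mathcal V$: (P1) if $v<v'$ and $E_i(v),E_i(v')$ are defined then $E_i(v)<E_i(v')$; (P2) $E_{\rm first}(\mathcal V)\ge\mathsf{GST}$; (P3) every correct process enters every $v\ge\mathcal V$; (P4) $E_{\rm last}(v)\le E_{\rm first}(v)+d$ for all $v\ge\mathcal V$; (P5) $E_{\rm first}(v+1)\ge E_{\rm first}(v)+F(v)$ for all $v\ge\mathcal V$. Two-phase HotStuff (code of $p_i$). $\mathsf{leader}(v)=p_{((v-1)\bmod n)+1}$. Variables $\mathsf{curr\_view},\mathsf{prepared\_view},\mathsf{locked\_view}$ are initially $0$; $\mathsf{curr\_val},\mathsf{prepared\_val},\mathsf{cert},\mathsf{voted}$ are initially $\bot$; $\mathsf{timer\_newleader}$ is a timer. A handler runs when its trigger and precondition hold; messages for views higher than the current one are buffered (for each type and sender, only the one with the highest view is kept). "All" includes the sender. 1. Upon $\mathtt{new\_view}(v)$: $\mathsf{curr\_view}:=v$; $\mathsf{voted}:=$ false; stop $\mathsf{timer\_newleader}$; if $p_i=\mathsf{leader}(v)$, start $\mathsf{timer\_newleader}$ with duration $F_p(v)$; send $\langle\mathtt{NEWLEADER}(v,\mathsf{prepared\_view},\mathsf{prepared\_val},\mathsf{cert})\rangle_i$ to $\mathsf{leader}(v)$. 2. (Once per view.) When $\mathsf{timer\_newleader}$ has expired, with $\mathsf{curr\_view}=v$ and $p_i=\mathsf{leader}(v)$: let $M=\{\langle\mathtt{NEWLEADER}(v,view_j,val_j,cert_j)\rangle_j\mid p_j\in P\}$ be the set of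 all received messages for $v$ satisfying ValidNewLeader; if there is $j$ with $view_j=\max\{view_k\mid p_k\in P\}\ne0$, send $\langle\mathtt{PROPOSE}(v,val_j,cert_j)\rangle_i$ to all; else send $\langle\mathtt{PROPOSE}(v,\mathtt{myval}(),\bot)\rangle_i$ to all. 3. When $m=\langle\mathtt{PROPOSE}(v,x,\_)\rangle_j$ is received, with $\mathsf{curr\_view}=v$, $\mathsf{voted}=$ false, SafeProposal$(m)$: $\mathsf{curr\_val}:=x$; $\mathsf{voted}:=$ true; send $\langle\mathtt{PREPARED}(v,\mathsf{hash}(x))\rangle_i$ to all. 4. When $C=\{\langle\mathtt{PREPARED}(v,h)\rangle_j\mid p_j\in Q\}$ is received for a quorum $Q$, with $\mathsf{curr\_view}=v$, $\mathsf{voted}=$ true, $\mathsf{hash}(\mathsf{curr\_val})=h$: $\mathsf{prepared\_val}:=\mathsf{curr\_val}$; $\mathsf{prepared\_view}:=v$; $\mathsf{locked\_view}:=v$; $\mathsf{cert}:=C$; send $\langle\mathtt{COMMITTED}(v,h)\rangle_i$ to all. 5. When $\{\langle\mathtt{COMMITTED}(v,h)\rangle_j\mid p_j\in Q\}$ is received for a quorum $Q$, with $\mathsf{curr\_view}=\mathsf{locked\_view}=v$, $\mathsf{hash}(\mathsf{curr\_val})=h$: decide $\mathsf{curr\_val}$. View-1 optimization: the leader of view $1$ sends $\langle\mathtt{PROPOSE}(1,\mathtt{myval}(),\bot)\rangle_i$ immediately on entering view $1$, without waiting. Predicates: prepared$(C,v,h)$ iff $C=\{\langle\mathtt{PREPARED}(v,h)\rangle_j\mid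 p_j\in Q\}$ for some quorum $Q$. ValidNewLeader$(\langle\mathtt{NEWLEADER}(v',v,x,C)\rangle_{\_})$ iff $v<v'$ and ($v\ne0$ implies prepared$(C,v,\mathsf{hash}(x))$). SafeProposal$(\langle\mathtt{PROPOSE}(v,x,C)\rangle_i)$, evaluated at the receiving process, iff $p_i=\mathsf{leader}(v)$, $\mathsf{valid}(x)$, and ($\mathsf{locked\_view}\ne0$ implies that $x=\mathsf{prepared\_val}$ or there is $v'$ with $v>v'>\mathsf{locked\_view}$ and prepared$(C,v',\mathsf{hash}(x))$). *)

theory Defs
  imports Complex_Main
begin

text \<open>
  A timed transition system for two-phase HotStuff.  All discrete steps are instantaneous; only
  the \<open>Elapse\<close> step advances real time.  A run is an infinite sequence of configurations
  \<open>c k\<close> and steps \<open>e k\<close> from \<open>c k\<close> to \<open>c (Suc k)\<close>.  The adversary resolves all nondeterminism: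
  faulty processes, message scheduling, synchronizer notifications and clock drift.
\<close>

type_synonym proc = nat
type_synonym view = nat

text \<open>A certificate element \<open>(j, v, h)\<close> is the message \<open>PREPARED(v, h)\<close> signed by \<open>j\<close>.\<close>

type_synonym 'h cert = "(proc \<times> view \<times> 'h) set"

text \<open>Message contents without signature; \<open>None\<close> stands for the undefined value or certificate.\<close>

datatype ('x, 'h) msg =
    NewLeader (mview: view) view "'x option" "'h cert option"
  | Propose (mview: view) 'x "'h cert option"
  | Prepared (mview: view) 'h
  | Committed (mview: view) 'h

datatype msg_kind = KNewLeader | KPropose | KPrepared | KCommitted

primrec kind :: "('x, 'h) msg \<Rightarrow> msg_kind" where
  "kind (NewLeader v w x C) = KNewLeader"
| "kind (Propose v x C) = KPropose"
| "kind (Prepared v h) = KPrepared"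
| "kind (Committed v h) = KCommitted"

primrec cert_of :: "('x, 'h) msg \<Rightarrow> 'h cert option" where
  "cert_of (NewLeader v w x C) = C"
| "cert_of (Propose v x C) = C"
| "cert_of (Prepared v h) = None"
| "cert_of (Committed v h) = None"

text \<open>
  A signed message on the link from \<open>src\<close> to \<open>dst\<close>.  The signer may differ from \<open>src\<close>, since a
  faulty process may relay messages signed by others.
\<close>

datatype ('x, 'h) packet =
  Packet (sent_at: real) (src: proc) (dst: proc) (signer: proc) (body: "('x, 'h) msg")

datatype handler = Lead | Vote | Lock | Decide

text \<open>
  \<open>timer\<close> is the local-clock reading at which \<open>timer_newleader\<close> expires (\<open>None\<close> if stopped).
  \<open>inbox\<close> holds the messages received so far, including the buffered ones for higher views.
  \<open>ran\<close> collects the handlers executed since the current view was entered.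
\<close>

record ('x, 'h) lstate =
  curr_view :: view
  prepared_view :: view
  locked_view :: view
  curr_val :: "'x option"
  prepared_val :: "'x option"
  cert :: "'h cert option"
  voted :: "bool option"
  timer :: "real option"
  inbox :: "('x, 'h) packet set"
  ran :: "handler set"
  decided :: "'x option"

definition init_lstate :: "('x, 'h) lstate" where
  "init_lstate = \<lparr> curr_view = 0, prepared_view = 0, locked_view = 0,
     curr_val = None, prepared_val = None, cert = None, voted = None,
     timer = None, inbox = {}, ran = {}, decided = None \<rparr>"

record ('x, 'h) config =
  now :: real
  loc :: "proc \<Rightarrow> ('x, 'h) lstate"
  sent :: "('x, 'h) packet set"

definition init_config :: "('x, 'h) config" where
  "init_config = \<lparr> now = 0, loc = (\<lambda>_. init_lstate), sent = {} \<rparr>"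

datatype ('x, 'h) step =
    Start proc
  | NewView proc view
  | Deliver "('x, 'h) packet"
  | Exec proc handler
  | FaultySend "('x, 'h) packet"
  | Elapse real

text \<open>
  Effect on the inbox of receiving \<open>p\<close>.  Messages for a higher view compete for a single slot per
  type and link sender; ties between messages of equal view are broken arbitrarily.
\<close>

definition buffer_slot :: "('x, 'h) lstate \<Rightarrow> ('x, 'h) packet \<Rightarrow> ('x, 'h) packet set" where
  "buffer_slot s p = {q \<in> inbox s. src q = src p \<and> kind (body q) = kind (body p)
     \<and> mview (body q) > curr_view s}"

definition receive ::
  "('x, 'h) lstate \<Rightarrow> ('x, 'h) packet \<Rightarrow> ('x, 'h) lstate \<Rightarrow> bool" where
  "receive s p s' \<longleftrightarrow>
     (if mview (body p) < curr_view s then s' = s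
      else if mview (body p) = curr_view s then s' = s\<lparr>inbox := insert p (inbox s)\<rparr>
      else \<exists>q \<in> insert p (buffer_slot s p).
             (\<forall>q' \<in> insert p (buffer_slot s p). mview (body q') \<le> mview (body q)) \<and>
             s' = s\<lparr>inbox := insert q (inbox s - buffer_slot s p)\<rparr>)"

definition received :: "('x, 'h) lstate \<Rightarrow> proc \<Rightarrow> ('x, 'h) msg \<Rightarrow> bool" where
  "received s j m \<longleftrightarrow> (\<exists>p \<in> inbox s. signer p = j \<and> body p = m)"

locale hotstuff =
  fixes f :: nat
    and faulty :: "proc set"
    and hash :: "'x \<Rightarrow> 'h"
    and valid :: "'x \<Rightarrow> bool"
    and myval :: "proc \<Rightarrow> 'x"
    and Fp :: "view \<Rightarrow> real"
    and clock :: "proc \<Rightarrow> real \<Rightarrow> real"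
  assumes faulty_subset: "faulty \<subseteq> {1..3 * f + 1}"
    and card_faulty: "card faulty \<le> f"
    and inj_hash: "inj hash"
    and valid_myval: "i \<in> {1..3 * f + 1} - faulty \<Longrightarrow> valid (myval i)"
    and Fp_nonneg: "0 \<le> Fp v"
    and mono_clock: "i \<in> {1..3 * f + 1} - faulty \<Longrightarrow> mono (clock i)"
begin

definition all_procs :: "proc set" where
  "all_procs = {1..3 * f + 1}"

definition correct :: "proc set" where
  "correct = all_procs - faulty"

definition quorum :: "proc set \<Rightarrow> bool" where
  "quorum Q \<longleftrightarrow> Q \<subseteq> all_procs \<and> card Q = 2 * f + 1"

definition leader :: "view \<Rightarrow> proc" where
  "leader v = (v - 1) mod (3 * f + 1) + 1"

definition prepared :: "'h cert option \<Rightarrow> view \<Rightarrow> 'h \<Rightarrow> bool" where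
  "prepared C v h \<longleftrightarrow> (\<exists>Q. quorum Q \<and> C = Some {(j, v, h) | j. j \<in> Q})"

definition valid_new_leader :: "view \<Rightarrow> view \<Rightarrow> 'x option \<Rightarrow> 'h cert option \<Rightarrow> bool" where
  "valid_new_leader v' v x C \<longleftrightarrow>
     v < v' \<and> (v \<noteq> 0 \<longrightarrow> (\<exists>y. x = Some y \<and> prepared C v (hash y)))"

definition safe_proposal ::
  "('x, 'h) lstate \<Rightarrow> proc \<Rightarrow> view \<Rightarrow> 'x \<Rightarrow> 'h cert option \<Rightarrow> bool" where
  "safe_proposal s j v x C \<longleftrightarrow>
     j = leader v \<and> valid x \<and>
     (locked_view s \<noteq> 0 \<longrightarrow>
        prepared_val s = Some x \<or>
        (\<exists>v'. v > v' \<and> v' > locked_view s \<and> prepared C v' (hash x)))"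

definition to_all :: "('x, 'h) msg \<Rightarrow> (proc \<times> ('x, 'h) msg) set" where
  "to_all m = {(j, m) | j. j \<in> all_procs}"

text \<open>
  Handler of \<open>new_view(v)\<close> at process \<open>i\<close> when its local clock reads \<open>t\<close>.  In view 1 the leader
  proposes at once; this counts as its (only) execution of \<open>Lead\<close> in that view.
\<close>

definition enter_view :: "proc \<Rightarrow> real \<Rightarrow> view \<Rightarrow> ('x, 'h) lstate \<Rightarrow> ('x, 'h) lstate" where
  "enter_view i t v s = s\<lparr> curr_view := v, voted := Some False,
     timer := (if i = leader v then Some (t + Fp v) else None),
     ran := (if v = 1 \<and> i = leader v then {Lead} else {}) \<rparr>"

definition enter_view_msgs ::
  "proc \<Rightarrow> view \<Rightarrow> ('x, 'h) lstate \<Rightarrow> (proc \<times> ('x, 'h) msg) set" where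
  "enter_view_msgs i v s =
     {(leader v, NewLeader v (prepared_view s) (prepared_val s) (cert s))} \<union>
     (if v = 1 \<and> i = leader v then to_all (Propose 1 (myval i) None) else {})"

definition new_leader_msgs :: "('x, 'h) lstate \<Rightarrow> (view \<times> 'x option \<times> 'h cert option) set" where
  "new_leader_msgs s = {(w, x, C) | w x C.
     (\<exists>j. received s j (NewLeader (curr_view s) w x C)) \<and> valid_new_leader (curr_view s) w x C}"

text \<open>
  \<open>handle i t h s s' out\<close>: at process \<open>i\<close>, whose local clock reads \<open>t\<close>, handler \<open>h\<close> is enabled in
  \<open>s\<close>, and executing it may lead to \<open>s'\<close> and send the (receiver, message) pairs \<open>out\<close>.  The field
  \<open>ran\<close> is updated separately.
\<close>

inductive handle ::
  "proc \<Rightarrow> real \<Rightarrow> handler \<Rightarrow> ('x, 'h) lstate \<Rightarrow> ('x, 'h) lstate \<Rightarrow>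
   (proc \<times> ('x, 'h) msg) set \<Rightarrow> bool" where
  lead_old:
    "\<lbrakk> i = leader (curr_view s); timer s = Some d; d \<le> t; Lead \<notin> ran s;
       (w, Some x, C) \<in> new_leader_msgs s; w = Max (fst ` new_leader_msgs s); w \<noteq> 0 \<rbrakk>
     \<Longrightarrow> handle i t Lead s s (to_all (Propose (curr_view s) x C))"
| lead_new:
    "\<lbrakk> i = leader (curr_view s); timer s = Some d; d \<le> t; Lead \<notin> ran s;
       \<not> (\<exists>(w, x, C) \<in> new_leader_msgs s. w = Max (fst ` new_leader_msgs s) \<and> w \<noteq> 0) \<rbrakk>
     \<Longrightarrow> handle i t Lead s s (to_all (Propose (curr_view s) (myval i) None))"
| vote:
    "\<lbrakk> received s j (Propose v x C); curr_view s = v; voted s = Some False;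
       safe_proposal s j v x C \<rbrakk>
     \<Longrightarrow> handle i t Vote s (s\<lparr> curr_val := Some x, voted := Some True \<rparr>)
           (to_all (Prepared v (hash x)))"
| lock:
    "\<lbrakk> quorum Q; \<forall>j \<in> Q. received s j (Prepared v h); curr_view s = v; voted s = Some True;
       curr_val s = Some x; hash x = h \<rbrakk>
     \<Longrightarrow> handle i t Lock s
           (s\<lparr> prepared_val := curr_val s, prepared_view := v, locked_view := v,
              cert := Some {(j, v, h) | j. j \<in> Q} \<rparr>)
           (to_all (Committed v h))"
| decide:
    "\<lbrakk> quorum Q; \<forall>j \<in> Q. received s j (Committed v h); curr_view s = v; locked_view s = v;
       curr_val s = Some x; hash x = h \<rbrakk>
     \<Longrightarrow> handle i t Decide s (s\<lparr> decided := curr_val s \<rparr>) {}"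

text \<open>
  Some handler still has to be executed.  \<open>Lock\<close> and \<open>Decide\<close> do not disable themselves; they may
  be executed again in a view (e.g. for another quorum), but only their first execution is forced.
\<close>

definition pending :: "proc \<Rightarrow> real \<Rightarrow> ('x, 'h) lstate \<Rightarrow> bool" where
  "pending i t s \<longleftrightarrow> (\<exists>h s' out. handle i t h s s' out \<and> h \<notin> ran s)"

definition packets ::
  "real \<Rightarrow> proc \<Rightarrow> (proc \<times> ('x, 'h) msg) set \<Rightarrow> ('x, 'h) packet set" where
  "packets t i out = {Packet t i j i m | j m. (j, m) \<in> out}"

definition has_signed :: "('x, 'h) packet set \<Rightarrow> proc \<Rightarrow> ('x, 'h) msg \<Rightarrow> bool" where
  "has_signed S j m \<longleftrightarrow> (\<exists>p \<in> S. signer p = j \<and> body p = m)"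

text \<open>Faulty processes can use a signature of a correct process only on what it has signed.\<close>

definition unforged :: "('x, 'h) packet set \<Rightarrow> ('x, 'h) packet \<Rightarrow> bool" where
  "unforged S p \<longleftrightarrow>
     signer p \<in> all_procs \<and>
     (signer p \<in> correct \<longrightarrow> has_signed S (signer p) (body p)) \<and>
     (\<forall>C j v h. cert_of (body p) = Some C \<longrightarrow> (j, v, h) \<in> C \<longrightarrow> j \<in> correct \<longrightarrow>
        has_signed S j (Prepared v h))"

inductive transition ::
  "('x, 'h) config \<Rightarrow> ('x, 'h) step \<Rightarrow> ('x, 'h) config \<Rightarrow> bool" where
  start: "i \<in> correct \<Longrightarrow> transition c (Start i) c"
| new_view:
    "\<lbrakk> i \<in> correct; v \<ge> 1 \<rbrakk>
     \<Longrightarrow> transition c (NewView i v)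
           (c\<lparr> loc := (loc c)(i := enter_view i (clock i (now c)) v (loc c i)),
              sent := sent c \<union> packets (now c) i (enter_view_msgs i v (loc c i)) \<rparr>)"
| deliver:
    "\<lbrakk> p \<in> sent c; dst p \<in> correct; receive (loc c (dst p)) p s' \<rbrakk>
     \<Longrightarrow> transition c (Deliver p) (c\<lparr> loc := (loc c)(dst p := s') \<rparr>)"
| exec:
    "\<lbrakk> i \<in> correct; handle i (clock i (now c)) h (loc c i) s' out \<rbrakk>
     \<Longrightarrow> transition c (Exec i h)
           (c\<lparr> loc := (loc c)(i := s'\<lparr> ran := insert h (ran s') \<rparr>),
              sent := sent c \<union> packets (now c) i out \<rparr>)"
| faulty_send:
    "\<lbrakk> src p \<in> faulty; dst p \<in> all_procs; sent_at p = now c; unforged (sent c) p \<rbrakk>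
     \<Longrightarrow> transition c (FaultySend p) (c\<lparr> sent := insert p (sent c) \<rparr>)"
| elapse: \<comment> \<open>local processing takes no time\<close>
    "\<lbrakk> now c < t; \<forall>i \<in> correct. \<forall>u. now c \<le> u \<and> u < t \<longrightarrow> \<not> pending i (clock i u) (loc c i) \<rbrakk>
     \<Longrightarrow> transition c (Elapse t) (c\<lparr> now := t \<rparr>)"

end

text \<open>
  Runs under partial synchrony.  Messages sent before \<open>GST\<close> need not be delivered at all, except
  for self-addressed ones.  The assumption \<open>entry_unique\<close> makes the entry time of a view well
  defined.
\<close>

locale hotstuff_run = hotstuff f faulty hash valid myval Fp clock
  for f :: nat
    and faulty :: "proc set"
    and hash :: "'x \<Rightarrow> 'h"
    and valid :: "'x \<Rightarrow> bool"
    and myval :: "proc \<Rightarrow> 'x"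
    and Fp :: "view \<Rightarrow> real"
    and clock :: "proc \<Rightarrow> real \<Rightarrow> real" +
  fixes GST :: real
    and \<delta> :: real
    and c :: "nat \<Rightarrow> ('x, 'h) config"
    and e :: "nat \<Rightarrow> ('x, 'h) step"
  assumes delta_nonneg: "0 \<le> \<delta>"
    and init: "c 0 = init_config"
    and steps: "transition (c k) (e k) (c (Suc k))"
    and time_diverges: "\<exists>k. T \<le> now (c k)"
    and no_drift: "i \<in> correct \<Longrightarrow> GST \<le> t \<Longrightarrow> GST \<le> u \<Longrightarrow> clock i u - clock i t = u - t"
    and timely: "p \<in> sent (c k) \<Longrightarrow> src p \<in> correct \<Longrightarrow> dst p \<in> correct \<Longrightarrow> GST \<le> sent_at p \<Longrightarrow>
       \<exists>l. e l = Deliver p \<and> now (c l) \<le> sent_at p + \<delta>"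
    and self_reliable: "p \<in> sent (c k) \<Longrightarrow> src p \<in> correct \<Longrightarrow> dst p = src p \<Longrightarrow>
       \<exists>l. e l = Deliver p"
    and eventually_start: "i \<in> correct \<Longrightarrow> \<exists>k. e k = Start i"
    and entry_unique: "e k = NewView i v \<Longrightarrow> e l = NewView i v \<Longrightarrow> k = l"

text \<open>The time at which \<open>i\<close> enters \<open>v\<close>, if it ever does.\<close>

definition entry_time ::
  "(nat \<Rightarrow> ('x, 'h) config) \<Rightarrow> (nat \<Rightarrow> ('x, 'h) step) \<Rightarrow> proc \<Rightarrow> view \<Rightarrow> real option" where
  "entry_time c e i v =
     (if \<exists>k. e k = NewView i v then Some (now (c (THE k. e k = NewView i v))) else None)"

definition E_first :: "proc set \<Rightarrow> (proc \<Rightarrow> view \<Rightarrow> real option) \<Rightarrow> view \<Rightarrow> real" where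
  "E_first P E v = Min {t. \<exists>i \<in> P. E i v = Some t}"

definition E_last :: "proc set \<Rightarrow> (proc \<Rightarrow> view \<Rightarrow> real option) \<Rightarrow> view \<Rightarrow> real" where
  "E_last P E v = Max {t. \<exists>i \<in> P. E i v = Some t}"

text \<open>
  The synchronizer specification for view \<open>V\<close>, where \<open>P\<close> is the set of correct processes and
  \<open>E i v\<close> is the time at which \<open>i\<close> enters \<open>v\<close>.
\<close>

locale synchronizer_spec =
  fixes P :: "proc set"
    and E :: "proc \<Rightarrow> view \<Rightarrow> real option"
    and F :: "view \<Rightarrow> real"
    and GST :: real
    and V :: view
    and d :: real
  assumes V_pos: "V \<ge> 1"
    and mono_F: "mono F"
    and F_0: "F 0 = 0"
    and P1: "i \<in> P \<Longrightarrow> v < v' \<Longrightarrow> E i v = Some t \<Longrightarrow> E i v' = Some t' \<Longrightarrow> t < t'"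
    and P2: "E_first P E V \<ge> GST"
    and P3: "i \<in> P \<Longrightarrow> v \<ge> V \<Longrightarrow> E i v \<noteq> None"
    and P4: "v \<ge> V \<Longrightarrow> E_last P E v \<le> E_first P E v + d"
    and P5: "v \<ge> V \<Longrightarrow> E_first P E (v + 1) \<ge> E_first P E v + F v"

end

theory Submission
  imports Defs
begin

text \<open>
  Choose a view \<open>v\<close> with a correct leader that is so late that \<open>F v - Fp v > 5\<delta>\<close> and \<open>Fp v > 3\<delta>\<close>.
  Let \<open>t0\<close> be the time of the first entry into \<open>v\<close>; no correct process leaves \<open>v\<close> before
  \<open>t0 + F v\<close>.  All \<open>NEWLEADER\<close> messages of correct processes reach the leader by \<open>t0 + 3\<delta>\<close>, before
  it proposes, so its choice covers the lock of every correct process: either the chosen certificate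
  is newer than the lock, or it has the same view and, by quorum intersection, the same value.
  The leader proposes at some time \<open>T \<le> t0 + 2\<delta> + Fp v\<close>; all correct processes then vote by \<open>T + \<delta>\<close>,
  lock by \<open>T + 2\<delta>\<close> and decide by \<open>T + 3\<delta> < t0 + F v\<close>.
\<close>

section \<open>Reception of messages into the inbox\<close>

lemma receive_inbox:
  assumes "receive s p s'"
  shows "\<exists>I \<subseteq> insert p (inbox s). s' = s\<lparr>inbox := I\<rparr>"
proof -
  consider "s' = s" | q where "q \<in> insert p (buffer_slot s p)"
      "s' = s\<lparr>inbox := insert q (inbox s - buffer_slot s p)\<rparr>"
    | "s' = s\<lparr>inbox := insert p (inbox s)\<rparr>"
    using assms unfolding receive_def by (metis (no_types))
  then show ?thesis
  proof cases
    case 1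
    show ?thesis by (rule exI[of _ "inbox s"]) (simp add: 1 subset_insertI)
  next
    case (2 q)
    show ?thesis
      by (rule exI[of _ "insert q (inbox s - buffer_slot s p)"])
        (use 2 in \<open>auto simp: buffer_slot_def\<close>)
  next
    case 3
    show ?thesis by (rule exI[of _ "insert p (inbox s)"]) (simp add: 3)
  qed
qed

text \<open>
  A message for the current view is never discarded; a buffered one only if some other message of
  the same type and link sender, for the same or a higher view, competes for its slot.
\<close>

lemma receive_keeps:
  assumes "receive s p' s'" and "p \<in> inbox s \<or> p = p' \<and> curr_view s \<le> mview (body p)"
    and "\<And>q. \<lbrakk>q \<in> insert p' (inbox s); curr_view s < mview (body p); src q = src p;
           kind (body q) = kind (body p); mview (body p) \<le> mview (body q)\<rbrakk> \<Longrightarrow> q = p"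
  shows "p \<in> inbox s'"
proof (cases "curr_view s < mview (body p')")
  case False
  with assms(1,2) show ?thesis by (auto simp: receive_def split: if_splits)
next
  case True
  then obtain q where q: "q \<in> insert p' (buffer_slot s p')"
    and q_max: "\<And>q'. q' \<in> insert p' (buffer_slot s p') \<Longrightarrow> mview (body q') \<le> mview (body q)"
    and s': "s' = s\<lparr>inbox := insert q (inbox s - buffer_slot s p')\<rparr>"
    using assms(1) by (auto simp: receive_def split: if_splits)
  \<comment> \<open>If \<open>p\<close> competes for the slot, the winner \<open>q\<close> has at
    least its view, so the third assumption gives \<open>q = p\<close>; otherwise \<open>p\<close>
    lies in the inbox outside the slot and stays there.\<close>
  show ?thesis
  proof (cases "p \<in> insert p' (buffer_slot s p')")
    case True
    have "curr_view s < mview (body p)"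
      using True \<open>curr_view s < mview (body p')\<close> by (auto simp: buffer_slot_def)
    moreover have "src q = src p" "kind (body q) = kind (body p)"
      using True q by (auto simp: buffer_slot_def)
    moreover have "q \<in> insert p' (inbox s)"
      using q by (auto simp: buffer_slot_def)
    ultimately have "q = p"
      using assms(3) q_max[OF True] by blast
    then show ?thesis using s' by simp
  next
    case False
    with assms(2) s' show ?thesis by auto
  qed
qed

section \<open>Correct processes, quorums and leader rotation\<close>

context hotstuff
begin

lemma finite_correct: "finite correct"
  by (simp add: correct_def all_procs_def)

lemma correct_subset: "correct \<subseteq> all_procs"
  by (auto simp: correct_def)

lemma card_correct: "2 * f + 1 \<le> card correct"
proof -
  have "card correct = card all_procs - card faulty"
    unfolding correct_def using faulty_subset
    by (intro card_Diff_subset) (auto simp: all_procs_def finite_subset)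
  then show ?thesis using card_faulty by (simp add: all_procs_def)
qed

lemma correct_nonempty: "correct \<noteq> {}"
  using card_correct by auto

lemma correct_quorum: "\<exists>Q. quorum Q \<and> Q \<subseteq> correct"
  using obtain_subset_with_card_n[OF card_correct] correct_subset
  by (metis quorum_def subset_trans)

text \<open>Two sets of \<open>2 * f + 1\<close> out of \<open>3 * f + 1\<close> processes share at
  least \<open>f + 1\<close>, of which at most \<open>f\<close> are faulty.\<close>

lemma quorum_intersection:
  assumes "quorum Q" "quorum Q'"
  shows "\<exists>j \<in> correct. j \<in> Q \<and> j \<in> Q'"
proof (rule ccontr)
  assume neg: "\<not> ?thesis"
  have fin: "finite Q" "finite Q'" "finite faulty"
    using assms faulty_subset by (auto simp: quorum_def all_procs_def finite_subset)
  have "Q \<inter> Q' \<subseteq> faulty"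
    using neg assms by (auto simp: quorum_def correct_def)
  then have "card (Q \<inter> Q') \<le> f"
    using card_faulty card_mono[of faulty] fin by (meson order_trans)
  moreover have "card (Q \<union> Q') \<le> 3 * f + 1"
    using assms card_mono[of all_procs "Q \<union> Q'"] by (auto simp: quorum_def all_procs_def)
  moreover have "card Q + card Q' = card (Q \<union> Q') + card (Q \<inter> Q')"
    using fin card_Un_Int by blast
  ultimately show False using assms by (auto simp: quorum_def)
qed

lemma prepared_certificate:
  assumes "prepared C w h"
  obtains Q D where "quorum Q" "C = Some D" "\<And>j. j \<in> Q \<Longrightarrow> (j, w, h) \<in> D"
  using assms by (auto simp: prepared_def)

text \<open>Leadership rotates with period \<open>3 * f + 1\<close>, so a correct \<open>i\<close>
  leads view \<open>(3 * f + 1) * w + i\<close>.\<close>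

lemma correct_leader_cofinal: "\<exists>v \<ge> w. leader v \<in> correct"
proof -
  obtain i where i: "i \<in> correct" using correct_nonempty by blast
  then have "1 \<le> i" "i \<le> 3 * f + 1" by (auto simp: correct_def all_procs_def)
  have "(3 * f + 1) * w + i - 1 = i - 1 + (3 * f + 1) * w" using \<open>1 \<le> i\<close> by simp
  then have "leader ((3 * f + 1) * w + i) = (i - 1) mod (3 * f + 1) + 1"
    unfolding leader_def by (simp only: mod_mult_self2)
  then have "leader ((3 * f + 1) * w + i) = i"
    using \<open>1 \<le> i\<close> \<open>i \<le> 3 * f + 1\<close> by simp
  moreover have "w \<le> (3 * f + 1) * w + i" by simp
  ultimately show ?thesis using i by metis
qed

lemma handle_frame:
  assumes "handle i t h s s' out"
  shows "curr_view s' = curr_view s" "inbox s' = inbox s" "ran s' = ran s" "timer s' = timer s"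
  using assms by (cases; simp)+

lemma packets_to_all: "packets t i (to_all m) = (\<lambda>j. Packet t i j i m) ` all_procs"
  by (auto simp: packets_def to_all_def)

lemma mem_packets_to_all: "j \<in> correct \<Longrightarrow> Packet t i j i m \<in> packets t i (to_all m)"
  by (auto simp: packets_to_all correct_def)

end

section \<open>Monotonicity and induction along a run\<close>

locale synchronized_run =
  hotstuff_run f faulty hash valid myval Fp clock GST \<delta> c e +
  synchronizer_spec "hotstuff.correct f faulty" "entry_time c e" F GST V "2 * \<delta>"
  for f faulty and hash :: "'x \<Rightarrow> 'h" and valid myval Fp clock GST \<delta>
    and c :: "nat \<Rightarrow> ('x, 'h) config" and e F V
begin

abbreviation st :: "nat \<Rightarrow> proc \<Rightarrow> ('x, 'h) lstate" where
  "st k i \<equiv> loc (c k) i"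

lemma st_0 [simp]: "st 0 i = init_lstate"
  by (simp add: init init_config_def)

lemma sent_0 [simp]: "sent (c 0) = {}"
  by (simp add: init init_config_def)

lemma now_mono: "k \<le> l \<Longrightarrow> now (c k) \<le> now (c l)"
proof (rule lift_Suc_mono_le[of "\<lambda>k. now (c k)"])
  show "now (c k) \<le> now (c (Suc k))" for k
    using steps[of k] by cases auto
qed

lemma sent_mono: "k \<le> l \<Longrightarrow> sent (c k) \<subseteq> sent (c l)"
proof (rule lift_Suc_mono_le[of "\<lambda>k. sent (c k)"])
  show "sent (c k) \<subseteq> sent (c (Suc k))" for k
    using steps[of k] by cases auto
qed

lemma now_less_imp_less: "now (c k) < now (c l) \<Longrightarrow> k < l"
  using now_mono by (meson not_le)

lemma entry_time_eq: "e k = NewView i v \<Longrightarrow> entry_time c e i v = Some (now (c k))"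
proof -
  assume *: "e k = NewView i v"
  then have "(THE k. e k = NewView i v) = k"
    by (rule the_equality) (rule entry_unique[OF _ *])
  with * show ?thesis unfolding entry_time_def by auto
qed

text \<open>Only \<open>NewView\<close> changes the view. This leads from local states to entry
  times, of which alone \<open>P1\<close> speaks.\<close>

lemma entered_current_view:
  "curr_view (st k i) = 0 \<or> (\<exists>k' < k. e k' = NewView i (curr_view (st k i)))"
proof (induction k)
  case 0
  show ?case by (simp add: init_lstate_def)
next
  case (Suc k)
  have "e k = NewView i (curr_view (st (Suc k) i)) \<or> curr_view (st (Suc k) i) = curr_view (st k i)"
    using steps[of k]
  proof cases
    case (deliver p s')
    then show ?thesis using receive_inbox[OF deliver(5)] by auto
  next
    case (exec j h s' out)
    then show ?thesis using handle_frame(1)[OF exec(4)] by auto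
  qed (auto simp: enter_view_def)
  with Suc show ?case using less_Suc_eq by metis
qed

text \<open>If the current view \<open>w\<close> were at least \<open>v\<close>, it would have been
  entered at an earlier step, hence not at a later time; but entries are unique, so
  \<open>v < w\<close>, and \<open>P1\<close> puts the entry into \<open>w\<close> strictly
  later.\<close>

lemma new_view_greater:
  assumes "e k = NewView i v"
  shows "curr_view (st k i) < v"
proof (rule ccontr)
  define w where "w = curr_view (st k i)"
  assume "\<not> curr_view (st k i) < v"
  then have "v \<le> w" by (simp add: w_def)
  have iv: "i \<in> correct" "1 \<le> v"
    using steps[of k] assms by (cases; simp)+
  then obtain k' where k': "k' < k" "e k' = NewView i w"
    using entered_current_view[of k i] \<open>v \<le> w\<close> w_def by auto
  have "v \<noteq> w" using entry_unique[OF assms] k' by auto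
  then have "v < w" using \<open>v \<le> w\<close> by simp
  then have "now (c k) < now (c k')"
    using P1[OF iv(1)] entry_time_eq[OF assms] entry_time_eq[OF k'(2)] by blast
  with k' now_mono[of k' k] show False by simp
qed

text \<open>Transitions from the viewpoint of \<open>i\<close>: steps that concern other processes
  or only time fall under \<open>idle\<close>. The invariants on local states are proved along these
  cases.\<close>

lemma local_step:
  obtains (idle) "st (Suc k) i = st k i"
  | (enter) w where "i \<in> correct" "e k = NewView i w" "curr_view (st k i) < w"
      "st (Suc k) i = enter_view i (clock i (now (c k))) w (st k i)"
  | (receipt) p where "p \<in> sent (c k)" "receive (st k i) p (st (Suc k) i)"
  | (exec) h s' out where "i \<in> correct" "e k = Exec i h"
      "handle i (clock i (now (c k))) h (st k i) s' out"
      "st (Suc k) i = s'\<lparr>ran := insert h (ran s')\<rparr>"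
  using steps[of k]
proof cases
  case (new_view j v)
  show ?thesis
  proof (cases "j = i")
    case True
    show ?thesis
      by (rule enter[of v]) (use new_view new_view_greater[of k i v] True in simp_all)
  next
    case False
    show ?thesis by (rule idle) (use new_view False in simp)
  qed
next
  case (deliver p s')
  show ?thesis
  proof (cases "dst p = i")
    case True
    show ?thesis by (rule receipt[of p]) (use deliver True in simp_all)
  next
    case False
    show ?thesis by (rule idle) (use deliver False in simp)
  qed
next
  case (exec j h s' out)
  show ?thesis
  proof (cases "j = i")
    case True
    show ?thesis by (rule that(4)[of h s' out]) (use exec True in simp_all)
  next
    case False
    show ?thesis by (rule idle) (use exec False in simp)
  qed
qed (rule idle, simp)+

lemma view_mono: "k \<le> l \<Longrightarrow> curr_view (st k i) \<le> curr_view (st l i)"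
proof (rule lift_Suc_mono_le[of "\<lambda>k. curr_view (st k i)"])
  show "curr_view (st k i) \<le> curr_view (st (Suc k) i)" for k
  proof (cases rule: local_step[of k i])
    case (receipt p)
    then show ?thesis using receive_inbox[OF receipt(2)] by auto
  next
    case (exec h s' out)
    then show ?thesis using handle_frame(1)[OF exec(3)] by simp
  qed (simp_all add: enter_view_def)
qed

text \<open>By \<open>view_mono\<close> no entry occurs while the view stays the same, so only
  receptions and handlers can change the state.\<close>

lemma within_view_induct [consumes 2, case_names base receipt exec]:
  assumes "k \<le> l" "curr_view (st l i) = curr_view (st k i)"
    and "P (st k i)"
    and "\<And>s I. P s \<Longrightarrow> P (s\<lparr>inbox := I\<rparr>)"
    and "\<And>m h s' out. \<lbrakk>k \<le> m; m < l; i \<in> correct; curr_view (st m i) = curr_view (st k i);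
           e m = Exec i h; P (st m i);
           handle i (clock i (now (c m))) h (st m i) s' out\<rbrakk> \<Longrightarrow> P (s'\<lparr>ran := insert h (ran s')\<rparr>)"
  shows "P (st l i)"
  using assms(1,2,5)
proof (induction l rule: dec_induct)
  case base
  show ?case by (rule assms(3))
next
  case (step l)
  have eq: "curr_view (st l i) = curr_view (st k i)"
    using view_mono[of k l i] view_mono[of l "Suc l" i] step.hyps step.prems(1) by simp
  then have P: "P (st l i)"
    using step by simp
  show ?case
  proof (cases rule: local_step[of l i])
    case idle
    with P show ?thesis by simp
  next
    case (enter w)
    with eq step.prems(1) show ?thesis by (simp add: enter_view_def)
  next
    case (receipt p)
    with P assms(4) receive_inbox show ?thesis by metis
  next
    case (exec h s' out)
    with step.prems(2)[of l h s' out] eq P step.hyps show ?thesis by simp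
  qed
qed

text \<open>Only \<open>Vote\<close> writes \<open>curr_val\<close>, and it requires
  \<open>voted\<close> to be false.\<close>

lemma voted_persists:
  assumes "k \<le> l" "curr_view (st l i) = curr_view (st k i)" "voted (st k i) = Some True"
  shows "voted (st l i) = Some True \<and> curr_val (st l i) = curr_val (st k i)"
  using assms(1,2)
  by (induction rule: within_view_induct) (use assms(3) in \<open>auto elim!: handle.cases\<close>)

lemma ran_persists:
  assumes "k \<le> l" "curr_view (st l i) = curr_view (st k i)" "h \<in> ran (st k i)"
  shows "h \<in> ran (st l i)"
  using assms(1,2)
  by (induction rule: within_view_induct) (use assms(3) in \<open>auto elim!: handle.cases\<close>)

subsection \<open>Messages\<close>

lemma inbox_sent: "inbox (st k i) \<subseteq> sent (c k)"
proof (induction k)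
  case 0
  show ?case by (simp add: init_lstate_def)
next
  case (Suc k)
  have mono: "sent (c k) \<subseteq> sent (c (Suc k))" by (simp add: sent_mono)
  show ?case
  proof (cases rule: local_step[of k i])
    case (receipt p)
    then obtain I where "inbox (st (Suc k) i) = I" "I \<subseteq> insert p (inbox (st k i))"
      using receive_inbox by fastforce
    then show ?thesis using receipt(1) Suc mono by blast
  next
    case (exec h s' out)
    then show ?thesis using handle_frame(2)[OF exec(3)] Suc mono by auto
  qed (use Suc mono in \<open>auto simp: enter_view_def\<close>)
qed

text \<open>Iterates \<open>receive_keeps\<close>. The last assumption is vacuous if the view of
  \<open>p\<close> is reached at \<open>k\<close>; for a buffered \<open>p\<close> it excludes
  rivals for the slot.\<close>

lemma inbox_persists:
  assumes "k \<le> l" "p \<in> inbox (st k i)"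
    and "\<And>q. \<lbrakk>q \<in> sent (c l); curr_view (st k i) < mview (body p); src q = src p;
           kind (body q) = kind (body p); mview (body p) \<le> mview (body q)\<rbrakk> \<Longrightarrow> q = p"
  shows "p \<in> inbox (st l i)"
  using assms(1,3)
proof (induction l rule: dec_induct)
  case base
  show ?case by (rule assms(2))
next
  case (step l)
  have mono: "sent (c l) \<subseteq> sent (c (Suc l))" by (simp add: sent_mono)
  have IH: "p \<in> inbox (st l i)"
    using step.IH step.prems mono by blast
  show ?case
  proof (cases rule: local_step[of l i])
    case (receipt p')
    have "insert p' (inbox (st l i)) \<subseteq> sent (c (Suc l))"
      using receipt(1) inbox_sent mono by auto
    moreover have "curr_view (st k i) \<le> curr_view (st l i)"
      using view_mono step.hyps by simp
    ultimately show ?thesis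
      using receive_keeps[OF receipt(2)] IH step.prems by (meson le_less_trans subsetD)
  next
    case (exec h s' out)
    then show ?thesis using handle_frame(2)[OF exec(3)] IH by simp
  qed (use IH in \<open>simp_all add: enter_view_def\<close>)
qed

lemma deliver_step:
  assumes "e k = Deliver p"
  shows "p \<in> sent (c k)" "receive (st k (dst p)) p (st (Suc k) (dst p))"
    "now (c (Suc k)) = now (c k)"
  using steps[of k] assms by (cases; simp)+

lemma new_view_step:
  assumes "e k = NewView i v"
  shows "i \<in> correct" "st (Suc k) i = enter_view i (clock i (now (c k))) v (st k i)"
    "sent (c (Suc k)) = sent (c k) \<union> packets (now (c k)) i (enter_view_msgs i v (st k i))"
    "now (c (Suc k)) = now (c k)"
  using steps[of k] assms by (cases; simp)+

lemma exec_step: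
  assumes "e k = Exec i h"
  obtains s' out where "i \<in> correct"
    "handle i (clock i (now (c k))) h (st k i) s' out"
    "st (Suc k) i = s'\<lparr>ran := insert h (ran s')\<rparr>"
    "sent (c (Suc k)) = sent (c k) \<union> packets (now (c k)) i out"
    "now (c (Suc k)) = now (c k)"
  using steps[of k] assms by (cases; simp)

lemma sent_new:
  assumes "p \<notin> sent (c k)" "p \<in> sent (c (Suc k))"
  obtains (entry) v where "e k = NewView (src p) v"
      "p \<in> packets (now (c k)) (src p) (enter_view_msgs (src p) v (st k (src p)))"
  | (handler) h where "e k = Exec (src p) h"
  | (fault) "unforged (sent (c k)) p" "src p \<in> faulty"
  using steps[of k]
proof cases
  case (new_view i v)
  show ?thesis
    by (rule entry[of v]) (use new_view assms in \<open>auto simp: packets_def\<close>)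
next
  case (exec i h s' out)
  show ?thesis
    by (rule handler[of h]) (use exec assms in \<open>auto simp: packets_def\<close>)
next
  case (faulty_send q)
  show ?thesis
    by (rule fault) (use faulty_send assms in auto)
qed (use assms in simp_all)

lemma first_sent:
  assumes "p \<in> sent (c k)"
  obtains k' where "k' < k" "p \<notin> sent (c k')" "p \<in> sent (c (Suc k'))"
proof -
  have "\<exists>k' < k. p \<notin> sent (c k') \<and> p \<in> sent (c (Suc k'))"
    using assms
  proof (induction k)
    case (Suc k)
    then show ?case using less_Suc_eq by (cases "p \<in> sent (c k)") auto
  qed simp
  with that show thesis by blast
qed

lemma sent_at_le_now:
  assumes "p \<in> sent (c k)"
  shows "sent_at p \<le> now (c k)"
proof -
  obtain k' where k': "k' < k" "p \<notin> sent (c k')" "p \<in> sent (c (Suc k'))"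
    using first_sent[OF assms] .
  have "sent_at p = now (c k')"
    using steps[of k'] by cases (use k' in \<open>auto simp: packets_def\<close>)
  with k'(1) now_mono[of k' k] show ?thesis by simp
qed

lemma mem_packetsD:
  "p \<in> packets t i out \<Longrightarrow> src p = i \<and> signer p = i \<and> sent_at p = t \<and> (dst p, body p) \<in> out"
  by (auto simp: packets_def)

text \<open>By \<open>unforged\<close>, relaying a correct signature requires the same signed body
  to be on the network already; going back through the relays ends at a packet sent by the signer
  itself.\<close>

lemma signer_is_source:
  assumes "p \<in> sent (c k)" "signer p \<in> correct"
  shows "\<exists>q \<in> sent (c k). src q = signer p \<and> body q = body p"
  using assms
proof (induction k arbitrary: p)
  case (Suc k)
  have mono: "sent (c k) \<subseteq> sent (c (Suc k))" by (simp add: sent_mono)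
  show ?case
  proof (cases "p \<in> sent (c k)")
    case True
    with Suc mono show ?thesis by blast
  next
    case False
    show ?thesis
    using False Suc.prems(1)
    proof (cases rule: sent_new)
      case (entry v)
      then show ?thesis using mem_packetsD Suc.prems by metis
    next
      case (handler h)
      then obtain out where "sent (c (Suc k)) = sent (c k) \<union> packets (now (c k)) (src p) out"
        by (rule exec_step)
      then have "p \<in> packets (now (c k)) (src p) out" using False Suc.prems by blast
      then show ?thesis using mem_packetsD Suc.prems by metis
    next
      case fault
      then obtain q where "q \<in> sent (c k)" "signer q = signer p" "body q = body p"
        using Suc.prems by (auto simp: unforged_def has_signed_def)
      then show ?thesis using Suc.IH[of q] Suc.prems mono by auto
    qed
  qed
qed simp

text \<open>Traces a correct signature to a step of the signer's own code, so that the content of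
  the message can be read off that step.\<close>

lemma sent_by_correct:
  assumes "p \<in> sent (c k)" "signer p \<in> correct"
  obtains (entry) k' v where "k' < k" "e k' = NewView (signer p) v"
      "\<exists>j. (j, body p) \<in> enter_view_msgs (signer p) v (st k' (signer p))"
  | (handler) k' h s' out where "k' < k" "e k' = Exec (signer p) h"
      "handle (signer p) (clock (signer p) (now (c k'))) h (st k' (signer p)) s' out"
      "st (Suc k') (signer p) = s'\<lparr>ran := insert h (ran s')\<rparr>"
      "\<exists>j. (j, body p) \<in> out"
      "sent (c (Suc k')) = sent (c k') \<union> packets (now (c k')) (signer p) out"
proof -
  obtain q where q: "q \<in> sent (c k)" "src q = signer p" "body q = body p"
    using signer_is_source[OF assms] by blast
  obtain k' where k': "k' < k" "q \<notin> sent (c k')" "q \<in> sent (c (Suc k'))"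
    using first_sent[OF q(1)] .
  show thesis
    using k'(2,3)
  proof (cases rule: sent_new)
    case (entry v)
    then have "(dst q, body q) \<in> enter_view_msgs (src q) v (st k' (src q))"
      using mem_packetsD by blast
    with entry(1) q k'(1) that(1) show thesis by metis
  next
    case (handler h)
    obtain s' out where s': "handle (src q) (clock (src q) (now (c k'))) h (st k' (src q)) s' out"
      "st (Suc k') (src q) = s'\<lparr>ran := insert h (ran s')\<rparr>"
      "sent (c (Suc k')) = sent (c k') \<union> packets (now (c k')) (src q) out"
      using exec_step[OF handler] by metis
    then have "(dst q, body q) \<in> out"
      using k' mem_packetsD by blast
    with s' handler q k'(1) show thesis by (intro that(2)[of k' h s' out]) auto
  next
    case fault
    with q assms(2) show thesis by (simp add: correct_def)
  qed
qed

lemma has_signed_mono: "has_signed (sent (c k)) j m \<Longrightarrow> k \<le> l \<Longrightarrow> has_signed (sent (c l)) j m"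
  using sent_mono unfolding has_signed_def by blast

lemma received_signed: "received (st k i) j m \<Longrightarrow> has_signed (sent (c k)) j m"
  using inbox_sent unfolding received_def has_signed_def by blast

text \<open>
  The last configuration with time at most \<open>T\<close>: since time then passes \<open>T\<close>, every handler that is
  enabled at \<open>T\<close> has already been executed.
\<close>

lemma snapshot:
  assumes "0 \<le> T"
  obtains l where "now (c l) \<le> T" "T < now (c (Suc l))"
    "\<And>i. i \<in> correct \<Longrightarrow> \<not> pending i (clock i T) (st l i)"
proof -
  obtain k where "T + 1 \<le> now (c k)" using time_diverges by blast
  then have "T < now (c k)" by simp
  moreover have "\<not> T < now (c 0)" using assms by (simp add: init init_config_def)
  ultimately obtain l where l: "\<not> T < now (c l)" "T < now (c (Suc l))"
    using ex_least_nat_less[of "\<lambda>k. T < now (c k)" k] by blast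
  \<comment> \<open>Only \<open>Elapse\<close> advances time, so step \<open>l\<close> is one, and
    its premise covers the instant \<open>u = T\<close>.\<close>
  have "\<not> pending i (clock i T) (st l i)" if "i \<in> correct" for i
    using steps[of l]
    by cases (use l that in auto)
  with l show thesis by (intro that[of l]) auto
qed

subsection \<open>Votes, locks and certificates\<close>

text \<open>The excluded case is the leader of view 1, whose \<open>ran\<close> holds
  \<open>Lead\<close> from entry on without any \<open>Exec\<close> step.\<close>

lemma ran_history:
  assumes "h \<in> ran (st l i)" "h \<noteq> Lead \<or> curr_view (st l i) \<noteq> 1"
  shows "\<exists>k < l. e k = Exec i h \<and> curr_view (st k i) = curr_view (st l i)"
  using assms
proof (induction l)
  case 0
  then show ?case by (simp add: init_lstate_def)
next
  case (Suc l)
  show ?case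
  proof (cases rule: local_step[of l i])
    case idle
    with Suc show ?thesis by (metis less_SucI)
  next
    case (enter w)
    with Suc show ?thesis by (auto simp: enter_view_def split: if_splits)
  next
    case (receipt p)
    then obtain I where "st (Suc l) i = st l i\<lparr>inbox := I\<rparr>"
      using receive_inbox by blast
    with Suc show ?thesis by (metis less_SucI lstate.ext_inject lstate.surjective lstate.update_convs(9))
  next
    case (exec h' s' out)
    have "curr_view (st (Suc l) i) = curr_view (st l i)" "ran (st (Suc l) i) = insert h' (ran (st l i))"
      using exec(4) handle_frame[OF exec(3)] by simp_all
    with Suc exec(2) show ?thesis by (metis insertE less_SucI lessI)
  qed
qed

text \<open>Links \<open>voted\<close> to \<open>ran\<close>, the record by which
  \<open>pending\<close> forces handlers. Before the first entry \<open>voted\<close> is still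
  \<open>None\<close>.\<close>

lemma voted_iff:
  "curr_view (st k i) \<noteq> 0 \<Longrightarrow> voted (st k i) = Some (Vote \<in> ran (st k i))"
proof (induction k)
  case 0
  then show ?case by (simp add: init_lstate_def)
next
  case (Suc k)
  show ?case
  proof (cases rule: local_step[of k i])
    case idle
    with Suc show ?thesis by simp
  next
    case (enter w)
    then show ?thesis by (simp add: enter_view_def)
  next
    case (receipt p)
    with Suc show ?thesis using receive_inbox[OF receipt(2)] by fastforce
  next
    case (exec h s' out)
    have "curr_view (st k i) \<noteq> 0"
      using Suc.prems exec(4) handle_frame[OF exec(3)] by simp
    with Suc.IH have IH: "voted (st k i) = Some (Vote \<in> ran (st k i))" .
    from exec(3) show ?thesis
      by cases (simp_all add: exec(4) IH)
  qed
qed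

text \<open>\<open>Lock\<close> sets all these fields together and no other step touches them. Hence
  the \<open>NEWLEADER\<close> message sent on entry reports the lock exactly and with a proper
  certificate.\<close>

lemma lock_invariant:
  "locked_view (st k i) = prepared_view (st k i) \<and> locked_view (st k i) \<le> curr_view (st k i) \<and>
   (locked_view (st k i) \<noteq> 0 \<longrightarrow>
     (\<exists>x. prepared_val (st k i) = Some x \<and> prepared (cert (st k i)) (locked_view (st k i)) (hash x)))"
proof (induction k)
  case 0
  then show ?case by (simp add: init_lstate_def)
next
  case (Suc k)
  show ?case
  proof (cases rule: local_step[of k i])
    case idle
    with Suc show ?thesis by auto
  next
    case (enter w)
    with Suc show ?thesis by (auto simp: enter_view_def)
  next
    case (receipt p)
    with Suc show ?thesis using receive_inbox[OF receipt(2)] by fastforce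
  next
    case (exec h s' out)
    from exec(3) show ?thesis
      by cases (use Suc exec(4) in \<open>auto simp: prepared_def\<close>)
  qed
qed

text \<open>
  State and network are treated together, since certificates travel from one to the other.
\<close>

lemma cert_signed:
  "(\<forall>i j w h D. cert (st k i) = Some D \<longrightarrow> (j, w, h) \<in> D \<longrightarrow> j \<in> correct \<longrightarrow>
      has_signed (sent (c k)) j (Prepared w h)) \<and>
   (\<forall>p \<in> sent (c k). \<forall>j w h D. cert_of (body p) = Some D \<longrightarrow> (j, w, h) \<in> D \<longrightarrow> j \<in> correct \<longrightarrow>
      has_signed (sent (c k)) j (Prepared w h))"
proof (induction k)
  case 0
  then show ?case by (simp add: init_lstate_def)
next
  case (Suc k)
  have mono: "has_signed (sent (c k)) j m \<Longrightarrow> has_signed (sent (c (Suc k))) j m" for j m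
    using has_signed_mono by simp
  have state: "has_signed (sent (c (Suc k))) j (Prepared w h)"
    if D: "cert (st (Suc k) i) = Some D" "(j, w, h) \<in> D" "j \<in> correct" for i j w h D
  proof (cases rule: local_step[of k i])
    case idle
    with Suc D mono show ?thesis by auto
  next
    case (enter w)
    with Suc D mono show ?thesis by (auto simp: enter_view_def)
  next
    case (receipt p)
    then have "cert (st (Suc k) i) = cert (st k i)" using receive_inbox by fastforce
    with Suc D mono show ?thesis by auto
  next
    case (exec h' s' out)
    then have "cert (st (Suc k) i) = cert s'" by simp
    moreover have "cert s' = Some D \<Longrightarrow> cert (st k i) = Some D \<or> received (st k i) j (Prepared w h)"
      using exec(3) D(2) by cases auto
    ultimately show ?thesis using Suc D mono received_signed by metis
  qed
  have packet: "has_signed (sent (c (Suc k))) j (Prepared w h)"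
    if p: "p \<in> sent (c (Suc k))" and D: "cert_of (body p) = Some D" "(j, w, h) \<in> D" "j \<in> correct"
    for p j w h D
  proof (cases "p \<in> sent (c k)")
    case True
    with Suc D mono show ?thesis by blast
  next
    case False
    show ?thesis
      using False p
    proof (cases rule: sent_new)
      case (entry v)
      then have "(dst p, body p) \<in> enter_view_msgs (src p) v (st k (src p))"
        using mem_packetsD by blast
      then have "cert (st k (src p)) = Some D"
        using D(1) by (auto simp: enter_view_msgs_def to_all_def split: if_splits)
      then show ?thesis using Suc D mono by blast
    next
      case (handler h')
      obtain s' out where s': "handle (src p) (clock (src p) (now (c k))) h' (st k (src p)) s' out"
        "sent (c (Suc k)) = sent (c k) \<union> packets (now (c k)) (src p) out"
        using exec_step[OF handler] by metis
      then have "(dst p, body p) \<in> out"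
        using p False mem_packetsD by blast
      \<comment> \<open>Among the handlers only \<open>lead_old\<close> sends a certificate, copied
        from a received \<open>NEWLEADER\<close>.\<close>
      with s'(1) D(1) obtain q where "q \<in> inbox (st k (src p))" "cert_of (body q) = Some D"
        by cases (auto simp: to_all_def new_leader_msgs_def received_def)
      then show ?thesis using Suc D mono inbox_sent by blast
    next
      case fault
      then show ?thesis using D mono by (auto simp: unforged_def)
    qed
  qed
  show ?case using state packet by blast
qed

text \<open>Only \<open>Vote\<close> sends \<open>PREPARED\<close>; it checks \<open>valid\<close>
  through \<open>safe_proposal\<close>, and its switch of \<open>voted\<close> is what uniqueness
  rests on.\<close>

lemma prepared_origin:
  assumes "has_signed (sent (c k)) i (Prepared w h)" "i \<in> correct"
  obtains k' x where "e k' = Exec i Vote" "curr_view (st k' i) = w" "voted (st k' i) = Some False"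
    "valid x" "h = hash x" "curr_view (st (Suc k') i) = w" "voted (st (Suc k') i) = Some True"
    "curr_val (st (Suc k') i) = Some x"
proof -
  obtain p where p: "p \<in> sent (c k)" "signer p = i" "body p = Prepared w h"
    using assms(1) by (auto simp: has_signed_def)
  from p(1) assms(2)[folded p(2)] show thesis
  proof (cases rule: sent_by_correct)
    case (entry k' v)
    with p show ?thesis by (auto simp: enter_view_msgs_def to_all_def split: if_splits)
  next
    case (handler k' g s' out)
    from handler(3) show ?thesis
    proof cases
      case (vote j v x C)
      with handler p show ?thesis
        by (intro that[of k' x]) (auto simp: to_all_def safe_proposal_def)
    qed (use handler p in \<open>auto simp: to_all_def\<close>)
  qed
qed

text \<open>A correct process votes once per view: by \<open>voted_persists\<close>,
  \<open>voted\<close> does not return to false before the view is left.\<close>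

lemma prepared_unique:
  assumes "has_signed (sent (c k)) i (Prepared w h)" "has_signed (sent (c k)) i (Prepared w h')"
    and "i \<in> correct"
  shows "h = h'"
proof -
  obtain k1 x1 where 1: "curr_view (st k1 i) = w" "voted (st k1 i) = Some False"
    "h = hash x1" "curr_view (st (Suc k1) i) = w" "voted (st (Suc k1) i) = Some True"
    "curr_val (st (Suc k1) i) = Some x1"
    using prepared_origin[OF assms(1,3)] by metis
  obtain k2 x2 where 2: "curr_view (st k2 i) = w" "voted (st k2 i) = Some False"
    "h' = hash x2" "curr_view (st (Suc k2) i) = w" "voted (st (Suc k2) i) = Some True"
    "curr_val (st (Suc k2) i) = Some x2"
    using prepared_origin[OF assms(2,3)] by metis
  have "k1 = k2"
  proof (rule ccontr)
    assume "k1 \<noteq> k2"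
    then consider "Suc k1 \<le> k2" | "Suc k2 \<le> k1" by linarith
    then show False
      using voted_persists[of "Suc k1" k2 i] voted_persists[of "Suc k2" k1 i] 1 2
      by cases simp_all
  qed
  with 1 2 show ?thesis by simp
qed

text \<open>Some correct member of the quorum checked validity before voting; injectivity of
  \<open>hash\<close> transfers this to \<open>x\<close>.\<close>

lemma certified_valid:
  assumes "prepared C w (hash x)"
    and "\<And>D j h. \<lbrakk>C = Some D; (j, w, h) \<in> D; j \<in> correct\<rbrakk> \<Longrightarrow> has_signed (sent (c k)) j (Prepared w h)"
  shows "valid x"
proof -
  obtain Q D where Q: "quorum Q" "C = Some D" "\<And>j. j \<in> Q \<Longrightarrow> (j, w, hash x) \<in> D"
    using prepared_certificate[OF assms(1)] by blast
  then obtain j where "j \<in> correct" "j \<in> Q" using quorum_intersection by blast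
  with Q assms(2) have "has_signed (sent (c k)) j (Prepared w (hash x))" "j \<in> correct" by auto
  then obtain y where "valid y" "hash x = hash y" using prepared_origin by metis
  then show ?thesis using inj_hash by (simp add: inj_eq)
qed

text \<open>The two quorums share a correct process, which has voted for only one hash in view
  \<open>w\<close>.\<close>

lemma certified_unique:
  assumes "prepared C w (hash x)" "prepared C' w (hash x')"
    and "\<And>D j h. \<lbrakk>C = Some D; (j, w, h) \<in> D; j \<in> correct\<rbrakk> \<Longrightarrow> has_signed (sent (c k)) j (Prepared w h)"
    and "\<And>D j h. \<lbrakk>C' = Some D; (j, w, h) \<in> D; j \<in> correct\<rbrakk> \<Longrightarrow> has_signed (sent (c k)) j (Prepared w h)"
  shows "x = x'"
proof -
  obtain Q D where Q: "quorum Q" "C = Some D" "\<And>j. j \<in> Q \<Longrightarrow> (j, w, hash x) \<in> D"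
    using prepared_certificate[OF assms(1)] by blast
  obtain Q' D' where Q': "quorum Q'" "C' = Some D'" "\<And>j. j \<in> Q' \<Longrightarrow> (j, w, hash x') \<in> D'"
    using prepared_certificate[OF assms(2)] by blast
  obtain j where "j \<in> correct" "j \<in> Q" "j \<in> Q'" using quorum_intersection Q Q' by blast
  then have "hash x = hash x'" using Q Q' assms(3,4) prepared_unique by metis
  then show ?thesis using inj_hash by (simp add: inj_eq)
qed

text \<open>\<open>Lock\<close> requires a vote in the current view.\<close>

lemma lock_unchanged_before_vote:
  assumes "k \<le> l" "curr_view (st l i) = curr_view (st k i)" "curr_view (st k i) \<noteq> 0"
    and "voted (st l i) = Some False"
  shows "locked_view (st l i) = locked_view (st k i) \<and> prepared_val (st l i) = prepared_val (st k i)"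
proof -
  \<comment> \<open>The disjunction is inductive: the lock may change once a vote is cast, but then
    \<open>voted\<close> remains true within the view.\<close>
  have "voted (st l i) = Some True \<or> locked_view (st l i) = locked_view (st k i) \<and>
      prepared_val (st l i) = prepared_val (st k i)"
    using assms(1,2)
    by (induction rule: within_view_induct) (auto elim!: handle.cases)
  with assms(4) show ?thesis by simp
qed

lemma lock_persists:
  assumes "k \<le> l" "curr_view (st l i) = curr_view (st k i)" "locked_view (st k i) = curr_view (st k i)"
  shows "locked_view (st l i) = curr_view (st k i)"
  using assms(1,2)
  by (induction rule: within_view_induct) (use assms(3) in \<open>auto elim!: handle.cases\<close>)

section \<open>The leader's timer and its single proposal\<close>

lemma timer_persists:
  assumes "k \<le> l" "curr_view (st l i) = curr_view (st k i)"
  shows "timer (st l i) = timer (st k i)"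
  using assms by (induction rule: within_view_induct) (simp_all add: handle_frame)

text \<open>\<open>lead_old\<close> and \<open>lead_new\<close> are exhaustive: for a nonzero
  maximal view, validity guarantees the \<open>Some\<close> that \<open>lead_old\<close> asks
  for.\<close>

lemma lead_pending:
  assumes "i = leader (curr_view s)" "timer s = Some d" "d \<le> t" "Lead \<notin> ran s"
  shows "pending i t s"
proof (cases "\<exists>(w, x, C) \<in> new_leader_msgs s. w = Max (fst ` new_leader_msgs s) \<and> w \<noteq> 0")
  case True
  then obtain w x C where "(w, x, C) \<in> new_leader_msgs s" "w = Max (fst ` new_leader_msgs s)" "w \<noteq> 0"
    by blast
  moreover from this obtain y where "x = Some y"
    by (auto simp: new_leader_msgs_def valid_new_leader_def)
  ultimately show ?thesis
    using lead_old[OF assms] assms(4) unfolding pending_def by blast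
next
  case False
  then show ?thesis using lead_new[OF assms] assms(4) unfolding pending_def by blast
qed

text \<open>\<open>ran\<close> only grows within a view, so \<open>h\<close> can pass from absent to
  present at one step only.\<close>

lemma handler_once:
  assumes "h \<notin> ran (st k1 i)" "h \<in> ran (st (Suc k1) i)" "curr_view (st k1 i) = v" "curr_view (st (Suc k1) i) = v"
    and "h \<notin> ran (st k2 i)" "h \<in> ran (st (Suc k2) i)" "curr_view (st k2 i) = v" "curr_view (st (Suc k2) i) = v"
  shows "k1 = k2"
proof (rule ccontr)
  assume "k1 \<noteq> k2"
  then consider "Suc k1 \<le> k2" | "Suc k2 \<le> k1" by linarith
  then show False
    using ran_persists[of "Suc k1" k2 i h] ran_persists[of "Suc k2" k1 i h] assms
    by cases simp_all
qed

text \<open>From view 2 on a proposal can stem only from \<open>Lead\<close>; in view 1 the leader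
  proposes on entry.\<close>

lemma proposal_origin:
  assumes "has_signed (sent (c k)) L (Propose v x C)" "L \<in> correct" "2 \<le> v"
  obtains k' where "k' < k" "Lead \<notin> ran (st k' L)" "Lead \<in> ran (st (Suc k') L)"
    "curr_view (st k' L) = v" "curr_view (st (Suc k') L) = v"
    "sent (c (Suc k')) = sent (c k') \<union> packets (now (c k')) L (to_all (Propose v x C))"
proof -
  obtain p where p: "p \<in> sent (c k)" "signer p = L" "body p = Propose v x C"
    using assms(1) by (auto simp: has_signed_def)
  from p(1) assms(2)[folded p(2)] show thesis
  proof (cases rule: sent_by_correct)
    case (entry k' w)
    with p assms(3) show ?thesis by (auto simp: enter_view_msgs_def to_all_def split: if_splits)
  next
    case (handler k' g s' out)
    have "g = Lead \<and> Lead \<notin> ran (st k' L) \<and> curr_view (st k' L) = v \<and> curr_view s' = v \<and>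
        out = to_all (Propose v x C)"
      using handler(3,5) p by cases (auto simp: to_all_def)
    with handler p show ?thesis by (intro that[of k']) auto
  qed
qed

text \<open>By \<open>handler_once\<close> both proposals come from the same execution of
  \<open>Lead\<close>, which sends just one.\<close>

lemma proposal_unique:
  assumes "has_signed (sent (c k)) L (Propose v x C)" "has_signed (sent (c k)) L (Propose v x' C')"
    and "L \<in> correct" "2 \<le> v"
  shows "x = x' \<and> C = C'"
proof -
  obtain k1 where 1: "Lead \<notin> ran (st k1 L)" "Lead \<in> ran (st (Suc k1) L)"
    "curr_view (st k1 L) = v" "curr_view (st (Suc k1) L) = v"
    "sent (c (Suc k1)) = sent (c k1) \<union> packets (now (c k1)) L (to_all (Propose v x C))"
    using proposal_origin[OF assms(1,3,4)] by metis
  obtain k2 where 2: "Lead \<notin> ran (st k2 L)" "Lead \<in> ran (st (Suc k2) L)"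
    "curr_view (st k2 L) = v" "curr_view (st (Suc k2) L) = v"
    "sent (c (Suc k2)) = sent (c k2) \<union> packets (now (c k2)) L (to_all (Propose v x' C'))"
    using proposal_origin[OF assms(2,3,4)] by metis
  have "k2 = k1" by (rule handler_once[OF 2(1-4) 1(1-4)])
  \<comment> \<open>To compare the two unions, a packet is needed that is new at this step. The
    leader's packet to itself is: an earlier copy would mean an earlier execution of
    \<open>Lead\<close> in the same view.\<close>
  let ?p = "Packet (now (c k1)) L L L (Propose v x C)"
  have "?p \<in> sent (c (Suc k1))"
    using 1(5) assms(3) by (simp add: mem_packets_to_all)
  moreover have "?p \<notin> sent (c k1)"
  proof
    assume "?p \<in> sent (c k1)"
    then have "has_signed (sent (c k1)) L (Propose v x C)" by (force simp: has_signed_def)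
    then obtain k0 where 0: "k0 < k1" "Lead \<notin> ran (st k0 L)" "Lead \<in> ran (st (Suc k0) L)"
      "curr_view (st k0 L) = v" "curr_view (st (Suc k0) L) = v"
      using proposal_origin assms(3,4) by metis
    then show False using handler_once[OF 0(2-5) 1(1-4)] by simp
  qed
  ultimately show ?thesis
    using 2(5) unfolding \<open>k2 = k1\<close> by (auto simp: packets_to_all)
qed

subsection \<open>A late view with a correct leader\<close>

text \<open>Makes \<open>Min\<close> and \<open>Max\<close> in \<open>E_first\<close> and
  \<open>E_last\<close> genuine bounds.\<close>

lemma finite_entry_times: "finite {t. \<exists>i \<in> correct. entry_time c e i w = Some t}"
proof (rule finite_subset)
  show "{t. \<exists>i \<in> correct. entry_time c e i w = Some t} \<subseteq> (\<lambda>i. the (entry_time c e i w)) ` correct"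
    by force
qed (simp add: finite_correct)

lemma entry:
  assumes "i \<in> correct" "V \<le> w"
  obtains a where "e a = NewView i w" "E_first correct (entry_time c e) w \<le> now (c a)"
    "now (c a) \<le> E_first correct (entry_time c e) w + 2 * \<delta>"
proof -
  obtain a where a: "e a = NewView i w"
    using P3[OF assms] by (auto simp: entry_time_def split: if_splits)
  have mem: "now (c a) \<in> {t. \<exists>i \<in> correct. entry_time c e i w = Some t}"
    using entry_time_eq[OF a] assms(1) by auto
  show thesis
    using that[OF a] Min_le[OF finite_entry_times mem] Max_ge[OF finite_entry_times mem] P4[OF assms(2)]
    unfolding E_first_def E_last_def by simp
qed

text \<open>\<open>P2\<close> gives this for \<open>V\<close>; \<open>P5\<close> and
  \<open>F w \<ge> F 0 = 0\<close> carry it to later views.\<close>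

lemma GST_le_E_first: "V \<le> w \<Longrightarrow> GST \<le> E_first correct (entry_time c e) w"
proof (induction w rule: dec_induct)
  case base
  show ?case by (rule P2)
next
  case (step w)
  have "0 \<le> F w" using mono_F F_0 by (metis le0 monoD)
  with step P5[of w] show ?case by simp
qed

text \<open>\<open>2 \<le> v\<close> avoids the immediate proposal of view 1. The
  \<open>3 * \<delta>\<close> are the entry spread plus one delay for \<open>NEWLEADER\<close>; the
  \<open>5 * \<delta>\<close> are the entry spread plus one delay each for \<open>PROPOSE\<close>,
  \<open>PREPARED\<close> and \<open>COMMITTED\<close>.\<close>

context
  fixes v :: view
  assumes V_le: "V \<le> v" and two_le: "2 \<le> v" and leader_correct: "leader v \<in> correct"
    and Fp_large: "3 * \<delta> < Fp v" and F_large: "Fp v + 5 * \<delta> < F v"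
begin

abbreviation t0 :: real where
  "t0 \<equiv> E_first correct (entry_time c e) v"

text \<open>By \<open>P5\<close> the entry into \<open>v + 1\<close> comes after step
  \<open>k\<close>, and the state just before that entry has view at most \<open>v\<close>.\<close>

lemma view_le:
  assumes "i \<in> correct" "now (c k) < t0 + F v"
  shows "curr_view (st k i) \<le> v"
proof -
  obtain b where b: "e b = NewView i (v + 1)" "E_first correct (entry_time c e) (v + 1) \<le> now (c b)"
    using entry[OF assms(1), of "v + 1"] V_le by auto
  then have "now (c k) < now (c b)" using P5[OF V_le] assms(2) by simp
  then have "curr_view (st k i) \<le> curr_view (st b i)"
    using now_less_imp_less view_mono by (meson less_imp_le)
  with new_view_greater[OF b(1)] show ?thesis by simp
qed

text \<open>The lower time bound is on \<open>Suc k\<close>, to suit configurations from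
  \<open>snapshot\<close>, whose own time may lie well before the instant considered.\<close>

lemma view_eq:
  assumes "i \<in> correct" "t0 + 2 * \<delta> < now (c (Suc k))" "now (c k) < t0 + F v"
  shows "curr_view (st k i) = v"
proof -
  obtain a where a: "e a = NewView i v" "now (c a) \<le> t0 + 2 * \<delta>"
    using entry[OF assms(1) V_le] by metis
  have "now (c (Suc a)) < now (c (Suc k))"
    using a assms(2) new_view_step(4)[OF a(1)] by simp
  then have "Suc a \<le> k" using now_less_imp_less by (metis Suc_less_eq Suc_le_eq)
  then have "v \<le> curr_view (st k i)"
    using view_mono[of "Suc a" k i] new_view_step(2)[OF a(1)] by (simp add: enter_view_def)
  with view_le[OF assms(1,3)] show ?thesis by simp
qed

text \<open>A message sent after \<open>t0 + 2 * \<delta>\<close> finds its receiver already in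
  \<open>v\<close>, so it is never subject to buffering.\<close>

lemma delivered_in_view:
  assumes "p \<in> sent (c k)" "src p \<in> correct" "dst p = i" "i \<in> correct" "mview (body p) = v"
    and "t0 + 2 * \<delta> < sent_at p" "sent_at p + \<delta> \<le> T" "T < t0 + F v"
    and "now (c l) \<le> T" "T < now (c (Suc l))"
  shows "p \<in> inbox (st l i)"
proof -
  have "GST \<le> sent_at p"
    using assms(6) GST_le_E_first[OF V_le] delta_nonneg by simp
  then obtain k' where k': "e k' = Deliver p" "now (c k') \<le> sent_at p + \<delta>"
    using timely assms by blast
  have "sent_at p \<le> now (c k')" using deliver_step(1)[OF k'(1)] sent_at_le_now by blast
  then have "curr_view (st k' i) = v"
    using assms k' deliver_step(3)[OF k'(1)] by (intro view_eq) auto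
  then have "p \<in> inbox (st (Suc k') i)"
    using receive_keeps[OF deliver_step(2)[OF k'(1)]] assms(3,5) by auto
  moreover have "now (c (Suc k')) < now (c (Suc l))"
    using deliver_step(3)[OF k'(1)] k'(2) assms by simp
  then have "Suc k' \<le> l" using now_less_imp_less by (metis Suc_less_eq Suc_le_eq)
  moreover have "v \<le> curr_view (st (Suc k') i)"
    using view_mono[of k' "Suc k'" i] \<open>curr_view (st k' i) = v\<close> by simp
  ultimately show ?thesis
    using inbox_persists[of "Suc k'" l p i] assms(5) by simp
qed

text \<open>Rules out rivals for the buffer slot: before \<open>t0 + F v\<close>, \<open>i\<close>
  enters no view above \<open>v\<close>, and it sends \<open>NEWLEADER\<close> only on entry. Relays
  by faulty processes have another \<open>src\<close>.\<close>

lemma new_leader_unique: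
  assumes "e a = NewView i v" "q \<in> sent (c k)" "src q = i" "kind (body q) = KNewLeader"
    and "v \<le> mview (body q)" "now (c k) < t0 + F v"
  shows "q = Packet (now (c a)) i (leader v) i
    (NewLeader v (prepared_view (st a i)) (prepared_val (st a i)) (cert (st a i)))"
proof -
  have i: "i \<in> correct" using new_view_step(1)[OF assms(1)] .
  obtain k' where k': "k' < k" "q \<notin> sent (c k')" "q \<in> sent (c (Suc k'))"
    using first_sent[OF assms(2)] .
  from k'(2,3) show ?thesis
  proof (cases rule: sent_new)
    case (entry w)
    have q: "q = Packet (now (c k')) i (leader w) i
        (NewLeader w (prepared_view (st k' i)) (prepared_val (st k' i)) (cert (st k' i)))"
      using entry(2) assms(3,4)
      by (auto simp: packets_def enter_view_msgs_def to_all_def split: if_splits)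
    have "w = curr_view (st (Suc k') i)"
      using new_view_step(2)[OF entry(1)] assms(3) by (simp add: enter_view_def)
    also have "\<dots> \<le> curr_view (st k i)" using view_mono k'(1) by simp
    also have "\<dots> \<le> v" using view_le[OF i assms(6)] .
    finally have "w = v" using q assms(5) by simp
    then have "k' = a" using entry_unique assms(1,3) entry(1) by blast
    with q \<open>w = v\<close> show ?thesis by simp
  next
    case (handler h)
    obtain s' out where s': "handle i (clock i (now (c k'))) h (st k' i) s' out"
      "sent (c (Suc k')) = sent (c k') \<union> packets (now (c k')) i out"
      using exec_step[OF handler] assms(3) by metis
    then have "(dst q, body q) \<in> out" using k' mem_packetsD by blast
    with s'(1) assms(4) show ?thesis by cases (auto simp: to_all_def)
  next
    case fault
    with i assms(3) show ?thesis by (simp add: correct_def)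
  qed
qed

text \<open>The leader may still be in a lower view on arrival, so the message may have to survive
  in the buffer; \<open>new_leader_unique\<close> ensures that it does.\<close>

lemma new_leader_received:
  assumes "i \<in> correct" "e a = NewView i v" "t0 + 3 * \<delta> < now (c m)" "now (c m) < t0 + F v"
  shows "received (st m (leader v)) i
    (NewLeader v (prepared_view (st a i)) (prepared_val (st a i)) (cert (st a i)))"
proof -
  let ?L = "leader v"
  let ?p = "Packet (now (c a)) i ?L i
    (NewLeader v (prepared_view (st a i)) (prepared_val (st a i)) (cert (st a i)))"
  have unique: "q = ?p" if "q \<in> sent (c k)" "k \<le> m" "src q = i" "kind (body q) = KNewLeader"
    "v \<le> mview (body q)" for q k
    using new_leader_unique[OF assms(2) that(1,3,4,5)] now_mono[OF that(2)] assms(4) by simp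
  have "?p \<in> sent (c (Suc a))"
    using new_view_step(3)[OF assms(2)] by (auto simp: packets_def enter_view_msgs_def)
  obtain a' where "e a' = NewView i v" "t0 \<le> now (c a')" "now (c a') \<le> t0 + 2 * \<delta>"
    using entry[OF assms(1) V_le] .
  then have a: "t0 \<le> now (c a)" "now (c a) \<le> t0 + 2 * \<delta>"
    using entry_unique assms(2) by metis+
  then obtain k where k: "e k = Deliver ?p" "now (c k) \<le> now (c a) + \<delta>"
    using timely[OF \<open>?p \<in> sent (c (Suc a))\<close>] GST_le_E_first[OF V_le] assms(1) leader_correct by auto
  have "k < m" using k(2) a assms(3) by (intro now_less_imp_less) simp
  have in_inbox: "?p \<in> inbox (st (Suc k) ?L)"
  proof (rule receive_keeps)
    show "receive (st k ?L) ?p (st (Suc k) ?L)" using deliver_step(2)[OF k(1)] by simp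
    have "curr_view (st k ?L) \<le> v"
      using now_mono[of k m] \<open>k < m\<close> assms(4) leader_correct by (intro view_le) auto
    then show "?p \<in> inbox (st k ?L) \<or> ?p = ?p \<and> curr_view (st k ?L) \<le> mview (body ?p)" by simp
    show "q = ?p" if "q \<in> insert ?p (inbox (st k ?L))" "src q = src ?p"
      "kind (body q) = kind (body ?p)" "mview (body ?p) \<le> mview (body q)" for q
      using unique[of q k] that inbox_sent deliver_step(1)[OF k(1)] \<open>k < m\<close> by auto
  qed
  have "?p \<in> inbox (st m ?L)"
  proof (rule inbox_persists)
    show "?p \<in> inbox (st (Suc k) ?L)" by (rule in_inbox)
    show "Suc k \<le> m" using \<open>k < m\<close> by simp
    show "q = ?p" if "q \<in> sent (c m)" "src q = src ?p" "kind (body q) = kind (body ?p)"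
      "mview (body ?p) \<le> mview (body q)" for q
      using unique[of q m] that by simp
  qed
  then show ?thesis unfolding received_def by (rule bexI[rotated]) simp
qed

section \<open>Safety of the leader's proposal at every correct process\<close>

lemma entered_before:
  assumes "e a = NewView i v" "curr_view (st k i) = v"
  shows "a < k"
proof (rule ccontr)
  assume "\<not> a < k"
  then have "curr_view (st k i) \<le> curr_view (st a i)" using view_mono by simp
  with new_view_greater[OF assms(1)] assms(2) show False by simp
qed

text \<open>The lock that \<open>safe_proposal\<close> consults is the one reported to the leader,
  since \<open>NEWLEADER\<close> is built from the state just before entry.\<close>

lemma lock_at_entry:
  assumes "e a = NewView i v" "curr_view (st k i) = v" "voted (st k i) = Some False"
  shows "locked_view (st k i) = locked_view (st a i) \<and> prepared_val (st k i) = prepared_val (st a i)"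
  using lock_unchanged_before_vote[of "Suc a" k i] entered_before[OF assms(1,2)]
    new_view_step(2)[OF assms(1)] assms two_le by (simp add: enter_view_def)

text \<open>The report of \<open>i\<close> belongs to \<open>M\<close>, so the maximal view there
  bounds its lock \<open>pv\<close>. Under \<open>lead_new\<close> this maximum is 0, hence
  \<open>i\<close> holds no lock.\<close>

lemma proposal_safe:
  assumes "handle (leader v) t Lead (st m (leader v)) s' out" "curr_view (st m (leader v)) = v"
    and "t0 + 3 * \<delta> < now (c m)" "now (c m) < t0 + F v" "(j, Propose v x C) \<in> out"
    and "i \<in> correct" "curr_view (st k i) = v" "voted (st k i) = Some False"
  shows "safe_proposal (st k i) (leader v) v x C"
proof -
  define M where "M = new_leader_msgs (st m (leader v))"
  have M_iff: "(w, y, D) \<in> M \<longleftrightarrow>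
      (\<exists>j. received (st m (leader v)) j (NewLeader v w y D)) \<and> valid_new_leader v w y D" for w y D
    unfolding M_def new_leader_msgs_def assms(2) by blast
  \<comment> \<open>\<open>Max\<close> ranges over views only; validity bounds them by
    \<open>v\<close>, which yields finiteness.\<close>
  have "fst ` M \<subseteq> {..<v}"
    by (auto simp: M_iff valid_new_leader_def)
  then have fin: "finite (fst ` M)" using finite_subset by blast
  obtain a where a: "e a = NewView i v" "now (c a) \<le> t0 + 2 * \<delta>"
    using entry[OF assms(6) V_le] by metis
  \<comment> \<open>Signatures behind the certificate of \<open>i\<close> at its entry thus persist
    to \<open>m\<close>, where both certificates are compared.\<close>
  have "a \<le> m"
    using a(2) assms(3) delta_nonneg by (intro less_imp_le now_less_imp_less) simp
  define pv where "pv = prepared_view (st a i)"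
  have locked: "locked_view (st k i) = pv"
    using lock_at_entry[OF a(1) assms(7,8)] lock_invariant[of a i] by (simp add: pv_def)
  have own: "\<exists>y. prepared_val (st k i) = Some y \<and> prepared (cert (st a i)) pv (hash y)" if "pv \<noteq> 0"
    using that lock_at_entry[OF a(1) assms(7,8)] lock_invariant[of a i] by (auto simp: pv_def)
  have "valid_new_leader v pv (prepared_val (st a i)) (cert (st a i))"
    using lock_invariant[of a i] new_view_greater[OF a(1)]
    by (auto simp: valid_new_leader_def pv_def)
  then have mem: "(pv, prepared_val (st a i), cert (st a i)) \<in> M"
    using new_leader_received[OF assms(6) a(1) assms(3,4)] by (auto simp: M_iff pv_def)
  then have pv_mem: "pv \<in> fst ` M" by force
  then have pv_le: "pv \<le> Max (fst ` M)" using fin by simp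
  from assms(1) show ?thesis
  proof cases
    case (lead_old d w x' C')
    then have [simp]: "x' = x" "C' = C" using assms(5) by (auto simp: to_all_def)
    have w: "(w, Some x, C) \<in> M" "w = Max (fst ` M)" "w \<noteq> 0"
      using lead_old by (simp_all add: M_def)
    then obtain j' where j': "received (st m (leader v)) j' (NewLeader v w (Some x) C)"
      and "valid_new_leader v w (Some x) C"
      by (auto simp: M_iff)
    then have prep: "prepared C w (hash x)" and "w < v"
      using w(3) by (auto simp: valid_new_leader_def)
    obtain p where p: "p \<in> sent (c m)" "cert_of (body p) = C"
      using j' inbox_sent unfolding received_def by fastforce
    have signed: "has_signed (sent (c m)) j (Prepared w h)"
      if "C = Some D" "(j, w, h) \<in> D" "j \<in> correct" for j D h
      using cert_signed[of m] p that by blast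
    have "valid x" using certified_valid[OF prep signed] .
    moreover have "prepared_val (st k i) = Some x" if "pv = w"
    proof -
      obtain y where y: "prepared_val (st k i) = Some y" "prepared (cert (st a i)) w (hash y)"
        using own \<open>pv = w\<close> w(3) by auto
      have own_signed: "has_signed (sent (c m)) j (Prepared w h)"
        if "cert (st a i) = Some D" "(j, w, h) \<in> D" "j \<in> correct" for j D h
        using cert_signed[of a] that has_signed_mono[OF _ \<open>a \<le> m\<close>] by blast
      have "x = y" using certified_unique[OF prep y(2) signed own_signed] .
      with y(1) show ?thesis by simp
    qed
    ultimately show ?thesis
      using prep \<open>w < v\<close> pv_le w(2) locked unfolding safe_proposal_def
      by (metis le_neq_implies_less)
  next
    case (lead_new d)
    then have [simp]: "x = myval (leader v)" using assms(5) by (auto simp: to_all_def)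
    obtain w y D where "(w, y, D) \<in> M" "w = Max (fst ` M)"
      using Max_in[OF fin] pv_mem by fastforce
    then have "Max (fst ` M) = 0" using lead_new unfolding M_def by blast
    with pv_le locked show ?thesis
      using valid_myval leader_correct by (simp add: safe_proposal_def correct_def all_procs_def)
  qed
qed

text \<open>The snapshot at the expiry time \<open>now (c a) + Fp v\<close> forces
  \<open>Lead\<close>. The last clause makes \<open>x\<close> the only value a correct process can
  accept from the leader in \<open>v\<close>, and only after step \<open>m\<close>.\<close>

lemma leader_proposes:
  obtains m x C where "t0 + 3 * \<delta> < now (c m)" "now (c m) \<le> t0 + 2 * \<delta> + Fp v"
    "packets (now (c m)) (leader v) (to_all (Propose v x C)) \<subseteq> sent (c (Suc m))"
    "\<forall>i \<in> correct. \<forall>k. curr_view (st k i) = v \<longrightarrow> voted (st k i) = Some False \<longrightarrow>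
       safe_proposal (st k i) (leader v) v x C"
    "\<forall>k x' C'. has_signed (sent (c k)) (leader v) (Propose v x' C') \<longrightarrow> x' = x \<and> m < k"
proof -
  let ?L = "leader v"
  obtain a where a: "e a = NewView ?L v" "t0 \<le> now (c a)" "now (c a) \<le> t0 + 2 * \<delta>"
    using entry[OF leader_correct V_le] .
  have GST: "GST \<le> now (c a)" using a(2) GST_le_E_first[OF V_le] by simp
  have timer: "timer (st k ?L) = Some (clock ?L (now (c a)) + Fp v)" if "curr_view (st k ?L) = v" for k
    using timer_persists[of "Suc a" k ?L] entered_before[OF a(1) that] new_view_step(2)[OF a(1)] that
    by (simp add: enter_view_def)
  have "0 \<le> now (c a)" using now_mono[of 0 a] by (simp add: init init_config_def)
  then obtain l where l: "now (c l) \<le> now (c a) + Fp v" "now (c a) + Fp v < now (c (Suc l))"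
    "\<not> pending ?L (clock ?L (now (c a) + Fp v)) (st l ?L)"
    using snapshot[of "now (c a) + Fp v"] Fp_nonneg[of v] leader_correct by (metis add_nonneg_nonneg)
  have view_l: "curr_view (st l ?L) = v"
    using l a Fp_large F_large delta_nonneg leader_correct by (intro view_eq) auto
  have "clock ?L (now (c a)) + Fp v \<le> clock ?L (now (c a) + Fp v)"
    using no_drift[OF leader_correct, of "now (c a)" "now (c a) + Fp v"] GST Fp_nonneg[of v] by simp
  then have "Lead \<in> ran (st l ?L)"
    using lead_pending[of ?L "st l ?L"] timer[OF view_l] view_l l(3) by metis
  then obtain m where m: "m < l" "e m = Exec ?L Lead" "curr_view (st m ?L) = v"
    using ran_history[of Lead l ?L] view_l two_le by auto
  obtain s' out where s': "handle ?L (clock ?L (now (c m))) Lead (st m ?L) s' out"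
    "st (Suc m) ?L = s'\<lparr>ran := insert Lead (ran s')\<rparr>"
    "sent (c (Suc m)) = sent (c m) \<union> packets (now (c m)) ?L out"
    using exec_step[OF m(2)] by metis
  obtain x C d where out: "out = to_all (Propose v x C)" "Lead \<notin> ran (st m ?L)"
    "timer (st m ?L) = Some d" "d \<le> clock ?L (now (c m))"
    using s'(1) m(3) by cases auto
  have "now (c a) \<le> now (c m)"
    using entered_before[OF a(1) m(3)] now_mono by simp
  \<comment> \<open>\<open>Lead\<close> waits for a local clock reading; after \<open>GST\<close>
    the absence of drift converts it to real time.\<close>
  then have "now (c a) + Fp v \<le> now (c m)"
    using out(3,4) timer[OF m(3)] no_drift[OF leader_correct GST, of "now (c m)"] GST by simp
  then have time: "t0 + 3 * \<delta> < now (c m)" "now (c m) \<le> t0 + 2 * \<delta> + Fp v"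
    using a Fp_large l(1) now_mono[of m l] m(1) by simp_all
  have packets: "packets (now (c m)) ?L (to_all (Propose v x C)) \<subseteq> sent (c (Suc m))"
    using s'(3) out(1) by simp
  have safe: "safe_proposal (st k i) ?L v x C"
    if "i \<in> correct" "curr_view (st k i) = v" "voted (st k i) = Some False" for i k
    using proposal_safe[OF s'(1) m(3) time(1) _ _ that] time(2) F_large delta_nonneg out(1) leader_correct
      correct_subset by (auto simp: to_all_def)
  have only: "x' = x \<and> m < k" if signed: "has_signed (sent (c k)) ?L (Propose v x' C')" for k x' C'
  proof -
    obtain k' where k': "k' < k" "Lead \<notin> ran (st k' ?L)" "Lead \<in> ran (st (Suc k') ?L)"
      "curr_view (st k' ?L) = v" "curr_view (st (Suc k') ?L) = v"
      using proposal_origin[OF signed leader_correct two_le] by metis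
    have "curr_view (st (Suc m) ?L) = v" "Lead \<in> ran (st (Suc m) ?L)"
      using s'(2) handle_frame(1)[OF s'(1)] m(3) by simp_all
    then have "k' = m"
      using handler_once[OF k'(2-5) out(2)] m(3) by simp
    have "Packet (now (c m)) ?L ?L ?L (Propose v x C) \<in> sent (c (Suc m))"
      using mem_packets_to_all packets leader_correct by blast
    then have "has_signed (sent (c (Suc m))) ?L (Propose v x C)"
      by (force simp: has_signed_def)
    then have "has_signed (sent (c k)) ?L (Propose v x C)"
      using has_signed_mono k'(1) \<open>k' = m\<close> by simp
    then show ?thesis
      using proposal_unique[OF signed _ leader_correct two_le] k'(1) \<open>k' = m\<close> by blast
  qed
  show thesis by (rule that[OF time packets]) (use safe only in blast)+
qed

text \<open>Snapshots bound the forced steps only from above. The lower bound \<open>T\<close> is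
  proved along with them, because \<open>delivered_in_view\<close> needs messages sent after
  \<open>t0 + 2 * \<delta>\<close>.\<close>

lemma all_decide:
  assumes "i \<in> correct"
  shows "\<exists>k. decided (st k i) \<noteq> None"
proof -
  let ?L = "leader v"
  obtain m x C where m: "t0 + 3 * \<delta> < now (c m)" "now (c m) \<le> t0 + 2 * \<delta> + Fp v"
    and proposed: "packets (now (c m)) ?L (to_all (Propose v x C)) \<subseteq> sent (c (Suc m))"
    and safe: "\<forall>i \<in> correct. \<forall>k. curr_view (st k i) = v \<longrightarrow> voted (st k i) = Some False \<longrightarrow>
       safe_proposal (st k i) ?L v x C"
    and only: "\<forall>k x' C'. has_signed (sent (c k)) ?L (Propose v x' C') \<longrightarrow> x' = x \<and> m < k"
    by (rule leader_proposes)
  define T where "T = now (c m)"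
  have "0 \<le> T" using now_mono[of 0 m] by (simp add: T_def init init_config_def)
  have bounds: "t0 + 2 * \<delta> < T" "T + 3 * \<delta> < t0 + F v"
    using m F_large delta_nonneg by (simp_all add: T_def)
  \<comment> \<open>This all-correct quorum serves both later rounds: its messages are sure to
    arrive in time.\<close>
  obtain Q where Q: "quorum Q" "Q \<subseteq> correct" using correct_quorum by blast
  have in_view: "curr_view (st l i) = v"
    if "i \<in> correct" "now (c l) \<le> T + 3 * \<delta>" "T < now (c (Suc l))" for i l
    using that bounds by (intro view_eq) auto

  obtain l1 where l1: "now (c l1) \<le> T + \<delta>" "T + \<delta> < now (c (Suc l1))"
    "\<And>i. i \<in> correct \<Longrightarrow> \<not> pending i (clock i (T + \<delta>)) (st l1 i)"
    using snapshot[of "T + \<delta>"] \<open>0 \<le> T\<close> delta_nonneg by auto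
  have voting: "\<exists>k. T \<le> now (c k) \<and> now (c k) \<le> T + \<delta> \<and> now (c (Suc k)) = now (c k) \<and>
      curr_view (st k i) = v \<and> voted (st k i) = Some False \<and>
      curr_view (st (Suc k) i) = v \<and> voted (st (Suc k) i) = Some True \<and> curr_val (st (Suc k) i) = Some x \<and>
      packets (now (c k)) i (to_all (Prepared v (hash x))) \<subseteq> sent (c (Suc k))"
    if i: "i \<in> correct" for i
  proof -
    have view: "curr_view (st l1 i) = v" using in_view[OF i] l1 delta_nonneg by simp
    have "Packet T ?L i ?L (Propose v x C) \<in> inbox (st l1 i)"
    proof (rule delivered_in_view)
      show "now (c l1) \<le> T + \<delta>" by (rule l1(1))
      show "Packet T ?L i ?L (Propose v x C) \<in> sent (c (Suc m))"
        using mem_packets_to_all[OF i] proposed unfolding T_def by blast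
    qed (use i l1 bounds delta_nonneg leader_correct in simp_all)
    then have rec: "received (st l1 i) ?L (Propose v x C)" by (force simp: received_def)
    have "Vote \<in> ran (st l1 i)"
    proof (rule ccontr)
      assume not_ran: "Vote \<notin> ran (st l1 i)"
      then have unvoted: "voted (st l1 i) = Some False" using voted_iff[of l1 i] view two_le by simp
      show False
        using vote[OF rec view unvoted safe[rule_format, OF i view unvoted]] not_ran l1(3)[OF i]
        unfolding pending_def by blast
    qed
    then obtain k where k: "k < l1" "e k = Exec i Vote" "curr_view (st k i) = v"
      using ran_history[of Vote l1 i] view by auto
    obtain s' out where s': "handle i (clock i (now (c k))) Vote (st k i) s' out"
      "st (Suc k) i = s'\<lparr>ran := insert Vote (ran s')\<rparr>"
      "sent (c (Suc k)) = sent (c k) \<union> packets (now (c k)) i out" "now (c (Suc k)) = now (c k)"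
      using exec_step[OF k(2)] by metis
    from s'(1) show ?thesis
    proof cases
      case (vote j v' y C')
      \<comment> \<open>\<open>safe_proposal\<close> demands the leader's signature, so
        \<open>only\<close> fixes the accepted value and places the vote after
        \<open>m\<close>.\<close>
      then have "j = ?L" "v' = v" using k(3) by (auto simp: safe_proposal_def)
      then have "y = x" "m < k" using only received_signed vote(3) by blast+
      then show ?thesis
        using s' vote k now_mono[of m k] now_mono[of k l1] l1(1) \<open>v' = v\<close>
        by (intro exI[of _ k]) (auto simp: T_def)
    qed
  qed

  obtain l2 where l2: "now (c l2) \<le> T + 2 * \<delta>" "T + 2 * \<delta> < now (c (Suc l2))"
    "\<And>i. i \<in> correct \<Longrightarrow> \<not> pending i (clock i (T + 2 * \<delta>)) (st l2 i)"
    using snapshot[of "T + 2 * \<delta>"] \<open>0 \<le> T\<close> delta_nonneg by auto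
  have has_voted: "voted (st l i) = Some True \<and> curr_val (st l i) = Some x"
    if i: "i \<in> correct" and l: "now (c l) \<le> T + 3 * \<delta>" "T + \<delta> < now (c (Suc l))" for i l
  proof -
    obtain k where k: "now (c k) \<le> T + \<delta>" "now (c (Suc k)) = now (c k)"
      "curr_view (st (Suc k) i) = v" "voted (st (Suc k) i) = Some True" "curr_val (st (Suc k) i) = Some x"
      using voting[OF i] by blast
    have "Suc k < Suc l" using k l(2) by (intro now_less_imp_less) simp
    then show ?thesis
      using voted_persists[of "Suc k" l i] in_view[OF i l(1)] l(2) k delta_nonneg by simp
  qed
  have locking: "\<exists>k. T \<le> now (c k) \<and> now (c k) \<le> T + 2 * \<delta> \<and> now (c (Suc k)) = now (c k) \<and>
      curr_view (st (Suc k) i) = v \<and> locked_view (st (Suc k) i) = v \<and>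
      packets (now (c k)) i (to_all (Committed v (hash x))) \<subseteq> sent (c (Suc k))"
    if i: "i \<in> correct" for i
  proof -
    have view: "curr_view (st l2 i) = v" using in_view[OF i] l2 delta_nonneg by simp
    have voted: "voted (st l2 i) = Some True" "curr_val (st l2 i) = Some x"
      using has_voted[OF i, of l2] l2 delta_nonneg by simp_all
    have rec: "\<forall>j \<in> Q. received (st l2 i) j (Prepared v (hash x))"
    proof
      fix j assume "j \<in> Q"
      then have j: "j \<in> correct" using Q by blast
      then obtain k where k: "T \<le> now (c k)" "now (c k) \<le> T + \<delta>"
        "packets (now (c k)) j (to_all (Prepared v (hash x))) \<subseteq> sent (c (Suc k))"
        using voting by blast
      have "Packet (now (c k)) j i j (Prepared v (hash x)) \<in> inbox (st l2 i)"
      proof (rule delivered_in_view)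
        show "Packet (now (c k)) j i j (Prepared v (hash x)) \<in> sent (c (Suc k))"
          using mem_packets_to_all[OF i] k(3) by blast
        show "now (c l2) \<le> T + 2 * \<delta>" by (rule l2(1))
      qed (use k i j l2 bounds delta_nonneg in simp_all)
      then show "received (st l2 i) j (Prepared v (hash x))" by (force simp: received_def)
    qed
    have "Lock \<in> ran (st l2 i)"
      using lock[OF Q(1) rec view voted refl] l2(3)[OF i] unfolding pending_def by blast
    then obtain k where k: "k < l2" "e k = Exec i Lock" "curr_view (st k i) = v"
      using ran_history[of Lock l2 i] view by auto
    obtain s' out where s': "handle i (clock i (now (c k))) Lock (st k i) s' out"
      "st (Suc k) i = s'\<lparr>ran := insert Lock (ran s')\<rparr>"
      "sent (c (Suc k)) = sent (c k) \<union> packets (now (c k)) i out" "now (c (Suc k)) = now (c k)"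
      using exec_step[OF k(2)] by metis
    from s'(1) show ?thesis
    proof cases
      case (lock Q' v' h y)
      then have "v' = v" using k(3) by simp
      \<comment> \<open>The executed \<open>Lock\<close> may have used another quorum, but the value
        is frozen since the vote.\<close>
      have "curr_val (st l2 i) = curr_val (st k i)"
        using voted_persists[of k l2 i] lock k view by simp
      then have "y = x" using lock voted by simp
      obtain k' where k': "T \<le> now (c k')" "curr_view (st k' i) = v" "voted (st k' i) = Some False"
        using voting[OF i] by blast
      \<comment> \<open>\<open>k'\<close> is a state before the vote, which \<open>Lock\<close>
        presupposes; this yields the lower time bound.\<close>
      have "\<not> k \<le> k'" using voted_persists[of k k' i] lock k' k(3) by auto
      then have "T \<le> now (c k)" using k'(1) now_mono[of k' k] by simp
      then show ?thesis
        using s' lock k now_mono[of k l2] l2(1) \<open>v' = v\<close> \<open>y = x\<close>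
        by (intro exI[of _ k]) auto
    qed
  qed

  obtain l3 where l3: "now (c l3) \<le> T + 3 * \<delta>" "T + 3 * \<delta> < now (c (Suc l3))"
    "\<not> pending i (clock i (T + 3 * \<delta>)) (st l3 i)"
    using snapshot[of "T + 3 * \<delta>"] \<open>0 \<le> T\<close> delta_nonneg assms by (metis add_nonneg_nonneg mult_nonneg_nonneg zero_le_numeral)
  have view: "curr_view (st l3 i) = v" using in_view[OF assms] l3 delta_nonneg by simp
  have val: "curr_val (st l3 i) = Some x"
    using has_voted[OF assms, of l3] l3 delta_nonneg by simp
  obtain k where k: "now (c k) \<le> T + 2 * \<delta>" "now (c (Suc k)) = now (c k)"
    "curr_view (st (Suc k) i) = v" "locked_view (st (Suc k) i) = v"
    using locking[OF assms] by blast
  have "Suc k < Suc l3" using k l3 delta_nonneg by (intro now_less_imp_less) simp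
  then have locked: "locked_view (st l3 i) = v"
    using lock_persists[of "Suc k" l3 i] k view by simp
  have rec: "\<forall>j \<in> Q. received (st l3 i) j (Committed v (hash x))"
  proof
    fix j assume "j \<in> Q"
    then have j: "j \<in> correct" using Q by blast
    then obtain k where k: "T \<le> now (c k)" "now (c k) \<le> T + 2 * \<delta>"
      "packets (now (c k)) j (to_all (Committed v (hash x))) \<subseteq> sent (c (Suc k))"
      using locking by blast
    have "Packet (now (c k)) j i j (Committed v (hash x)) \<in> inbox (st l3 i)"
    proof (rule delivered_in_view)
      show "Packet (now (c k)) j i j (Committed v (hash x)) \<in> sent (c (Suc k))"
        using mem_packets_to_all[OF assms] k(3) by blast
      show "now (c l3) \<le> T + 3 * \<delta>" by (rule l3(1))
    qed (use k assms j l3 bounds delta_nonneg in simp_all)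
    then show "received (st l3 i) j (Committed v (hash x))" by (force simp: received_def)
  qed
  have "Decide \<in> ran (st l3 i)"
    using decide[OF Q(1) rec view locked val refl] l3(3) unfolding pending_def by blast
  then obtain k' where k': "e k' = Exec i Decide"
    using ran_history[of Decide l3 i] by auto
  obtain s' out where s': "handle i (clock i (now (c k'))) Decide (st k' i) s' out"
    "st (Suc k') i = s'\<lparr>ran := insert Decide (ran s')\<rparr>"
    using exec_step[OF k'] by metis
  from s'(1) have "decided s' \<noteq> None" by cases auto
  with s'(2) show ?thesis by (intro exI[of _ "Suc k'"]) simp
qed

end

end

theorem corollary11:
  fixes f :: nat
    and faulty :: "proc set"
    and hash :: "'x \<Rightarrow> 'h"
    and valid :: "'x \<Rightarrow> bool"
    and myval :: "proc \<Rightarrow> 'x"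
    and F Fp :: "view \<Rightarrow> real"
    and clock :: "proc \<Rightarrow> real \<Rightarrow> real"
    and GST \<delta> :: real
    and V :: view
    and c :: "nat \<Rightarrow> ('x, 'h) config"
    and e :: "nat \<Rightarrow> ('x, 'h) step"
  assumes "hotstuff_run f faulty hash valid myval Fp clock GST \<delta> c e"
    and "synchronizer_spec ({1..3 * f + 1} - faulty) (entry_time c e) F GST V (2 * \<delta>)"
    and "\<forall>\<theta> :: real. \<exists>v \<ge> 1. \<forall>v' \<ge> v. F v' > \<theta> \<and> Fp v' > \<theta> \<and> F v' - Fp v' > \<theta>"
  shows "\<forall>i \<in> {1..3 * f + 1} - faulty. \<exists>k. decided (loc (c k) i) \<noteq> None"
proof -
  interpret hotstuff_run f faulty hash valid myval Fp clock GST \<delta> c e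
    by (rule assms(1))
  have correct_eq: "{1..3 * f + 1} - faulty = correct"
    by (simp add: correct_def all_procs_def)
  interpret synchronized_run f faulty hash valid myval Fp clock GST \<delta> c e F V
    using assms(1,2) unfolding correct_eq by (intro synchronized_run.intro)
  \<comment> \<open>The single choice \<open>5 * \<delta>\<close> for the threshold meets both
    bounds, as \<open>\<delta>\<close> is nonnegative.\<close>
  obtain w where w: "\<And>v'. w \<le> v' \<Longrightarrow> 5 * \<delta> < Fp v' \<and> 5 * \<delta> < F v' - Fp v'"
    using assms(3) by meson
  obtain v where v: "max w (max V 2) \<le> v" "leader v \<in> correct"
    using correct_leader_cofinal by blast
  have "3 * \<delta> < Fp v" "Fp v + 5 * \<delta> < F v"
    using w[of v] v(1) delta_nonneg by auto
  then show ?thesis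
    using all_decide[of v] v unfolding correct_eq by simp
qed

end
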